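(* For $n \in \{3,4,5,6,8,10,12\}$, up to equivalence, all $n$-defective Lehmer pairs are of the form $$\left( \frac{\sqrt{a}-\sqrt{b}}{2}, \frac{\sqrt{a}+\sqrt{b}}{2} \right),$$ where $(a,b)$ is given in the following list, with $k, \ell, q \in \mathbb{Z}$ and $\varepsilon = \pm 1$. For $n=3$: - $(a,b)=(1+q,\,1-3q)$ with $q \neq -1,0,1$; or - $(a,b)=(3^{k}+q,\,3^{k}-3q)$ with $k>0$, $3 \nmid q$, $(k,q) \neq (1,1)$. For $n=4$: - $(a,b)=(1+2q,\,1-2q)$ with $q \neq -1,0,1$; or - $(a,b)=(2^{k}+2q,\,2^{k}-2q)$ with $k>0$, $2 \nmid q$, $(k,q) \notin \{(1,-1),(1,1),(2,1)\}$. For $n=5$: - $(a,b)=(\phi_{k-2\varepsilon},\,\phi_{k-2\varepsilon}-4\phi_{k})$ with $k \geq 3$; or - $(a,b)=(\psi_{k-2\varepsilon},\,\psi_{k-2\varepsilon}-4\psi_{k})$ with $k \geq 0$, $(k,\varepsilon) \notin \{(0,-1),(1,-1)\}$. For $n=6$: - $(a,b)=(1+3q,\,1-q)$ with $q \neq -1,0,1$; or - $(a,b)=(3^{\ell}+3q,\,3^{\ell}-q)$ with $\ell>0$, $3 \nmid q$, $(\ell,q) \neq (1,-1)$; or - $(a,b)=(2^{k}+3q,\,2^{k}-q)$ with $k>0$, $2 \nmid q$, $(k,q) \neq (1,-1)$; or - $(a,b)=(2^{k}3^{\ell}+3q,\,2^{k}3^{\ell}-q)$ with $k,\ell>0$,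 $\gcd(6,q)=1$. For $n=8$: - $(a,b)=(\rho_{k-\varepsilon},\,\rho_{k-\varepsilon}-4\pi_{k})$ with $k \geq 2$; or - $(a,b)=(2\pi_{k-\varepsilon},\,2\pi_{k-\varepsilon}-4\rho_{k})$ with $k \geq 2$. For $n=10$: - $(a,b)=(\phi_{k-2\varepsilon}-4\phi_{k},\,\phi_{k-2\varepsilon})$ with $k \geq 3$; or - $(a,b)=(\psi_{k-2\varepsilon}-4\psi_{k},\,\psi_{k-2\varepsilon})$ with $k \geq 0$, $(k,\varepsilon) \notin \{(0,-1),(1,-1)\}$. For $n=12$: - $(a,b)=(\zeta^{(i)}_{k-\varepsilon},\,-\zeta^{(i)}_{k+\varepsilon})$ with $i \in \{0,1,2,3\}$, $k \geq 0$, $(i,k,\varepsilon) \notin \{(0,0,\pm 1),(0,1,\pm 1),(1,0,\pm 1),(2,0,\pm 1)\}$.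
   Context: Lehmer pairs. A Lehmer pair is a pair $(\alpha,\beta)$ of algebraic integers such that $(\alpha+\beta)^{2}$ and $\alpha\beta$ are non-zero coprime rational integers and $\alpha/\beta$ is not a root of unity. For a Lehmer pair $(\alpha,\beta)$ the corresponding sequence of Lehmer numbers is $$\tilde{u}_{n}=\tilde{u}_{n}(\alpha,\beta)=\frac{\alpha^{n}-\beta^{n}}{\alpha-\beta}\ \text{ if } n \text{ is odd},\qquad \tilde{u}_{n}=\frac{\alpha^{n}-\beta^{n}}{\alpha^{2}-\beta^{2}}\ \text{ if } n \text{ is even}.$$ Primitive divisors. A prime number $r$ is a primitive divisor of $\tilde{u}_{n}(\alpha,\beta)$ if $r$ divides $\tilde{u}_{n}$ but does not divide $(\alpha^{2}-\beta^{2})^{2}\,\tilde{u}_{1}\cdots\tilde{u}_{n-1}$. A Lehmer pair $(\alpha,\beta)$ such that $\tilde{u}_{n}(\alpha,\beta)$ has no primitive divisors is called an $n$-defective Lehmer pair. Equivalence. Two Lehmer pairs $(\alpha_{1},\beta_{1})$ and $(\alpha_{2},\beta_{2})$ are equivalent if $\alpha_{1}/\alpha_{2}=\beta_{1}/\beta_{2}\in\{\pm 1,\pm\sqrt{-1}\}$. Square roots. For a Lehmer pair $(\alpha,\beta)$ put $P=(\alpha+\beta)^{2}$ and $Q=\alpha\beta$, and define $\sqrt{P}$ uniquely as $\alpha+\beta$; then $\alpha,\beta=(\sqrt{P}\pm\sqrt{P-4Q})/2$. In the form above, $a=P$ and $b=P-4Q$ (these integers may be negative). Sequences. - $(\phi_{k})_{k\geq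 -2}$ is the Fibonacci sequence extended to negative indices: $\phi_{-2}=-1$, $\phi_{-1}=1$, $\phi_{0}=0$, $\phi_{1}=1$, $\phi_{k+2}=\phi_{k+1}+\phi_{k}$. - $(\psi_{k})_{k\geq -2}$ is the classical Lucas sequence extended to negative indices: $\psi_{-2}=3$, $\psi_{-1}=-1$, $\psi_{0}=2$, $\psi_{1}=1$, $\psi_{k+2}=\psi_{k+1}+\psi_{k}$. - $(\pi_{k})_{k\geq -1}$: $\pi_{-1}=1$, $\pi_{0}=0$, $\pi_{1}=1$, $\pi_{k+1}=2\pi_{k}+\pi_{k-1}$. - $(\rho_{k})_{k\geq -1}$: $\rho_{-1}=-1$, $\rho_{0}=\rho_{1}=1$, $\rho_{k+1}=2\rho_{k}+\rho_{k-1}$. - $(\zeta^{(i)}_{k})_{k\geq -1}$ for $i=0,1,2,3$: all satisfy $\zeta^{(i)}_{k+1}=4\zeta^{(i)}_{k}-\zeta^{(i)}_{k-1}$, with $(\zeta^{(i)}_{-1},\zeta^{(i)}_{0},\zeta^{(i)}_{1})$ equal to $(-1,0,1)$ for $i=0$, $(2,1,2)$ for $i=1$, $(1,1,3)$ for $i=2$, and $(-1,1,5)$ for $i=3$.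
   Formalization: For n=4 the exclusion of (k,q)=(2,1) is dropped: it gives (a,b)=(6,2), i.e. P=6, Q=1, a 4-defective Lehmer pair (fourth Lehmer number 4, (α²−β²)²=12) that is not equivalent to any other pair in the list. *)

theory Defs
  imports Complex_Main "HOL-Computational_Algebra.Computational_Algebra"
begin

section \<open>Lehmer pairs and Lehmer numbers\<close>

definition lehmer_pair :: "complex \<Rightarrow> complex \<Rightarrow> bool" where
  "lehmer_pair \<alpha> \<beta> \<longleftrightarrow>
     algebraic_int \<alpha> \<and> algebraic_int \<beta> \<and>
     (\<exists>P Q :: int. (\<alpha> + \<beta>)\<^sup>2 = of_int P \<and> \<alpha> * \<beta> = of_int Q \<and> P \<noteq> 0 \<and> Q \<noteq> 0 \<and> coprime P Q) \<and>
     \<not> (\<exists>m::nat. m > 0 \<and> (\<alpha> / \<beta>) ^ m = 1)"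

definition lehmer_number :: "complex \<Rightarrow> complex \<Rightarrow> nat \<Rightarrow> complex" where
  "lehmer_number \<alpha> \<beta> n =
     (if odd n then (\<alpha> ^ n - \<beta> ^ n) / (\<alpha> - \<beta>) else (\<alpha> ^ n - \<beta> ^ n) / (\<alpha>\<^sup>2 - \<beta>\<^sup>2))"

text \<open>
  For a Lehmer pair, the Lehmer numbers and \<open>(\<alpha>\<^sup>2 - \<beta>\<^sup>2)\<^sup>2 = P * (P - 4 * Q)\<close> are rational integers,
  but as terms they have type \<^typ>\<open>complex\<close>, on which \<open>dvd\<close> is trivial. The following is
  divisibility in the ring of rational integers.
\<close>

definition int_dvd :: "nat \<Rightarrow> complex \<Rightarrow> bool" where
  "int_dvd r z \<longleftrightarrow> (\<exists>m::int. z = of_int m \<and> int r dvd m)"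

definition primitive_divisor :: "nat \<Rightarrow> complex \<Rightarrow> complex \<Rightarrow> nat \<Rightarrow> bool" where
  "primitive_divisor r \<alpha> \<beta> n \<longleftrightarrow>
     prime r \<and> int_dvd r (lehmer_number \<alpha> \<beta> n) \<and>
     \<not> int_dvd r ((\<alpha>\<^sup>2 - \<beta>\<^sup>2)\<^sup>2 * (\<Prod>j\<in>{1..<n}. lehmer_number \<alpha> \<beta> j))"

definition defective_lehmer_pair :: "nat \<Rightarrow> complex \<Rightarrow> complex \<Rightarrow> bool" where
  "defective_lehmer_pair n \<alpha> \<beta> \<longleftrightarrow> lehmer_pair \<alpha> \<beta> \<and> \<not> (\<exists>r. primitive_divisor r \<alpha> \<beta> n)"

definition equivalent_lehmer_pairs :: "complex \<times> complex \<Rightarrow> complex \<times> complex \<Rightarrow> bool" where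
  "equivalent_lehmer_pairs = (\<lambda>(\<alpha>\<^sub>1, \<beta>\<^sub>1) (\<alpha>\<^sub>2, \<beta>\<^sub>2).
     lehmer_pair \<alpha>\<^sub>1 \<beta>\<^sub>1 \<and> lehmer_pair \<alpha>\<^sub>2 \<beta>\<^sub>2 \<and>
     \<alpha>\<^sub>1 / \<alpha>\<^sub>2 = \<beta>\<^sub>1 / \<beta>\<^sub>2 \<and> \<alpha>\<^sub>1 / \<alpha>\<^sub>2 \<in> {1, -1, \<i>, -\<i>})"

section \<open>The recurrence sequences\<close>

text \<open>
  \<open>lin_rec c d x y\<close> is the sequence with initial values \<open>x\<close>, \<open>y\<close> and
  \<open>t (n + 2) = c * t (n + 1) + d * t n\<close>. The sequences below start at a negative index, so they
  are shifted; below that index their values are junk and never used.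
\<close>

fun lin_rec :: "int \<Rightarrow> int \<Rightarrow> int \<Rightarrow> int \<Rightarrow> nat \<Rightarrow> int" where
  "lin_rec c d x y 0 = x"
| "lin_rec c d x y (Suc 0) = y"
| "lin_rec c d x y (Suc (Suc n)) = c * lin_rec c d x y (Suc n) + d * lin_rec c d x y n"

definition fib_seq :: "int \<Rightarrow> int"  (\<open>\<phi>\<close>) where
  "\<phi> k = lin_rec 1 1 (-1) 1 (nat (k + 2))"

definition luc_seq :: "int \<Rightarrow> int"  (\<open>\<psi>\<close>) where
  "\<psi> k = lin_rec 1 1 3 (-1) (nat (k + 2))"

definition pell_seq :: "int \<Rightarrow> int"  (\<open>\<pi>\<close>) where
  "\<pi> k = lin_rec 2 1 1 0 (nat (k + 1))"

definition rho_seq :: "int \<Rightarrow> int"  (\<open>\<rho>\<close>) where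
  "\<rho> k = lin_rec 2 1 (-1) 1 (nat (k + 1))"

definition zeta_seq :: "nat \<Rightarrow> int \<Rightarrow> int"  (\<open>\<zeta>\<close>) where
  "\<zeta> i k = lin_rec 4 (-1) ([-1, 2, 1, -1] ! i) ([0, 1, 1, 1] ! i) (nat (k + 1))"

lemma lin_rec_shift:
  assumes "k \<ge> - s"
  shows "lin_rec c d x y (nat (k + 2 + s)) =
    c * lin_rec c d x y (nat (k + 1 + s)) + d * lin_rec c d x y (nat (k + s))"
proof -
  have "nat (k + 2 + s) = Suc (Suc (nat (k + s)))" "nat (k + 1 + s) = Suc (nat (k + s))"
    using assms by linarith+
  then show ?thesis by simp
qed

lemma fib_seq_rec: "k \<ge> -2 \<Longrightarrow> \<phi> (k + 2) = \<phi> (k + 1) + \<phi> k"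
  using lin_rec_shift[of 2 k] by (simp add: fib_seq_def)

lemma luc_seq_rec: "k \<ge> -2 \<Longrightarrow> \<psi> (k + 2) = \<psi> (k + 1) + \<psi> k"
  using lin_rec_shift[of 2 k] by (simp add: luc_seq_def)

lemma pell_seq_rec: "k \<ge> 0 \<Longrightarrow> \<pi> (k + 1) = 2 * \<pi> k + \<pi> (k - 1)"
  using lin_rec_shift[of 1 "k - 1"] by (simp add: pell_seq_def)

lemma rho_seq_rec: "k \<ge> 0 \<Longrightarrow> \<rho> (k + 1) = 2 * \<rho> k + \<rho> (k - 1)"
  using lin_rec_shift[of 1 "k - 1"] by (simp add: rho_seq_def)

lemma zeta_seq_rec: "k \<ge> 0 \<Longrightarrow> \<zeta> i (k + 1) = 4 * \<zeta> i k - \<zeta> i (k - 1)"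
  using lin_rec_shift[of 1 "k - 1"] by (simp add: zeta_seq_def)

lemma seq_initial_values:
  "\<phi> (-2) = -1" "\<phi> (-1) = 1" "\<phi> 0 = 0" "\<phi> 1 = 1"
  "\<psi> (-2) = 3" "\<psi> (-1) = -1" "\<psi> 0 = 2" "\<psi> 1 = 1"
  "\<pi> (-1) = 1" "\<pi> 0 = 0" "\<pi> 1 = 1"
  "\<rho> (-1) = -1" "\<rho> 0 = 1" "\<rho> 1 = 1"
  "\<zeta> 0 (-1) = -1" "\<zeta> 0 0 = 0" "\<zeta> 0 1 = 1"
  "\<zeta> 1 (-1) = 2" "\<zeta> 1 0 = 1" "\<zeta> 1 1 = 2"
  "\<zeta> 2 (-1) = 1" "\<zeta> 2 0 = 1" "\<zeta> 2 1 = 3"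
  "\<zeta> 3 (-1) = -1" "\<zeta> 3 0 = 1" "\<zeta> 3 1 = 5"
  by (simp_all add: fib_seq_def luc_seq_def pell_seq_def rho_seq_def zeta_seq_def eval_nat_numeral)

section \<open>The list of pairs $(a,b)$\<close>

text \<open>
  In rule \<open>four_b\<close> the published list also excludes \<open>(k, q) = (2, 1)\<close>. That exclusion is an error and
  is omitted: the resulting pair \<open>(a, b) = (6, 2)\<close>, i.e. \<open>P = 6\<close>, \<open>Q = 1\<close>, has fourth Lehmer number
  \<open>P - 2 * Q = 4\<close> and \<open>(\<alpha>\<^sup>2 - \<beta>\<^sup>2)\<^sup>2 = P * (P - 4 * Q) = 12\<close>, so it is 4-defective, and neither
  \<open>(6, 2)\<close> nor \<open>(-6, -2)\<close> occurs elsewhere in the list for \<open>n = 4\<close>.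
\<close>

inductive listed :: "nat \<Rightarrow> int \<Rightarrow> int \<Rightarrow> bool" where
  three_a: "q \<notin> {-1, 0, 1} \<Longrightarrow> listed 3 (1 + q) (1 - 3 * q)"
| three_b: "k > 0 \<Longrightarrow> \<not> 3 dvd q \<Longrightarrow> (k, q) \<noteq> (1, 1) \<Longrightarrow>
    listed 3 (3 ^ nat k + q) (3 ^ nat k - 3 * q)" for k :: int
| four_a: "q \<notin> {-1, 0, 1} \<Longrightarrow> listed 4 (1 + 2 * q) (1 - 2 * q)"
| four_b: "k > 0 \<Longrightarrow> \<not> 2 dvd q \<Longrightarrow> (k, q) \<notin> {(1, -1), (1, 1)} \<Longrightarrow>
    listed 4 (2 ^ nat k + 2 * q) (2 ^ nat k - 2 * q)" for k :: int
| five_a: "\<epsilon> \<in> {1, -1} \<Longrightarrow> k \<ge> 3 \<Longrightarrow>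
    listed 5 (\<phi> (k - 2 * \<epsilon>)) (\<phi> (k - 2 * \<epsilon>) - 4 * \<phi> k)"
| five_b: "\<epsilon> \<in> {1, -1} \<Longrightarrow> k \<ge> 0 \<Longrightarrow> (k, \<epsilon>) \<notin> {(0, -1), (1, -1)} \<Longrightarrow>
    listed 5 (\<psi> (k - 2 * \<epsilon>)) (\<psi> (k - 2 * \<epsilon>) - 4 * \<psi> k)"
| six_a: "q \<notin> {-1, 0, 1} \<Longrightarrow> listed 6 (1 + 3 * q) (1 - q)"
| six_b: "l > 0 \<Longrightarrow> \<not> 3 dvd q \<Longrightarrow> (l, q) \<noteq> (1, -1) \<Longrightarrow>
    listed 6 (3 ^ nat l + 3 * q) (3 ^ nat l - q)" for l :: int
| six_c: "k > 0 \<Longrightarrow> \<not> 2 dvd q \<Longrightarrow> (k, q) \<noteq> (1, -1) \<Longrightarrow>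
    listed 6 (2 ^ nat k + 3 * q) (2 ^ nat k - q)" for k :: int
| six_d: "k > 0 \<Longrightarrow> l > 0 \<Longrightarrow> gcd 6 q = 1 \<Longrightarrow>
    listed 6 (2 ^ nat k * 3 ^ nat l + 3 * q) (2 ^ nat k * 3 ^ nat l - q)" for k l :: int
| eight_a: "\<epsilon> \<in> {1, -1} \<Longrightarrow> k \<ge> 2 \<Longrightarrow> listed 8 (\<rho> (k - \<epsilon>)) (\<rho> (k - \<epsilon>) - 4 * \<pi> k)"
| eight_b: "\<epsilon> \<in> {1, -1} \<Longrightarrow> k \<ge> 2 \<Longrightarrow> listed 8 (2 * \<pi> (k - \<epsilon>)) (2 * \<pi> (k - \<epsilon>) - 4 * \<rho> k)"
| ten_a: "\<epsilon> \<in> {1, -1} \<Longrightarrow> k \<ge> 3 \<Longrightarrow>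
    listed 10 (\<phi> (k - 2 * \<epsilon>) - 4 * \<phi> k) (\<phi> (k - 2 * \<epsilon>))"
| ten_b: "\<epsilon> \<in> {1, -1} \<Longrightarrow> k \<ge> 0 \<Longrightarrow> (k, \<epsilon>) \<notin> {(0, -1), (1, -1)} \<Longrightarrow>
    listed 10 (\<psi> (k - 2 * \<epsilon>) - 4 * \<psi> k) (\<psi> (k - 2 * \<epsilon>))"
| twelve: "\<epsilon> \<in> {1, -1} \<Longrightarrow> i \<in> {0, 1, 2, 3} \<Longrightarrow> k \<ge> 0 \<Longrightarrow>
    (i, k) \<notin> {(0, 0), (0, 1), (1, 0), (2, 0)} \<Longrightarrow>
    listed 12 (\<zeta> i (k - \<epsilon>)) (- \<zeta> i (k + \<epsilon>))"

text \<open>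
  \<open>\<surd>a\<close> and \<open>\<surd>b\<close> stand for some square roots in \<^typ>\<open>complex\<close> (with \<open>\<surd>a = \<alpha> + \<beta>\<close>), not for the principal
  ones: changing the sign of one of them swaps the two components up to sign, and a pair
  is in general not equivalent to the swapped pair.
\<close>

definition has_form :: "int \<Rightarrow> int \<Rightarrow> complex \<times> complex \<Rightarrow> bool" where
  "has_form a b p \<longleftrightarrow> (\<exists>sa sb :: complex. sa\<^sup>2 = of_int a \<and> sb\<^sup>2 = of_int b \<and>
     p = ((sa - sb) / 2, (sa + sb) / 2))"

end

theory Submission
  imports Defs
begin

text \<open>
  Put \<open>P = (\<alpha> + \<beta>)\<^sup>2\<close> and \<open>Q = \<alpha> * \<beta>\<close>. The Lehmer number of index \<open>n\<close> contains the factor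
  \<open>\<Phi>\<^sub>n(\<alpha>, \<beta>)\<close>, a linear or quadratic form \<open>F(P, Q)\<close> for the indices at hand. Explicit Bezout
  identities show that a prime dividing \<open>F\<close> and also \<open>P * (P - 4 * Q)\<close> or an earlier Lehmer number
  divides a small constant, so in a defective pair \<open>F\<close> has no other prime factors. If \<open>F\<close> is linear,
  this says that \<open>F\<close> is up to sign a product of powers of 2 and 3; if \<open>F\<close> is quadratic, a congruence
  argument shows that \<open>F\<close> is squarefree, and completing the square yields finitely many Pell equations,
  whose solutions are the given sequences. The sign of \<open>(P, Q)\<close> is adjusted by multiplying
  \<open>(\<alpha>, \<beta>)\<close> with \<open>\<i>\<close>, and \<open>n = 10\<close> reduces to \<open>n = 5\<close> through \<open>(P, Q) \<mapsto> (P - 4 * Q, - Q)\<close>.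
\<close>

section \<open>Lehmer numbers as integers\<close>

text \<open>The Lehmer numbers as polynomials in \<open>P\<close> and \<open>Q\<close>. The
  recursion goes in steps of two indices, because within one parity class the normalising
  denominator is fixed and the terms satisfy the linear recurrence with roots \<alpha> squared and
  \<beta> squared, whose sum is \<open>P - 2 * Q\<close> and whose product is
  \<open>Q\<^sup>2\<close>.\<close>

fun lehmer_int :: "int \<Rightarrow> int \<Rightarrow> nat \<Rightarrow> int" where
  "lehmer_int P Q 0 = 0"
| "lehmer_int P Q (Suc 0) = 1"
| "lehmer_int P Q (Suc (Suc 0)) = 1"
| "lehmer_int P Q (Suc (Suc (Suc 0))) = P - Q"
| "lehmer_int P Q (Suc (Suc (Suc (Suc n)))) =
     (P - 2 * Q) * lehmer_int P Q (Suc (Suc n)) - Q\<^sup>2 * lehmer_int P Q n"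

lemma lehmer_int_add_4:
  "lehmer_int P Q (n + 4) = (P - 2 * Q) * lehmer_int P Q (n + 2) - Q\<^sup>2 * lehmer_int P Q n"
  by (simp add: numeral_eq_Suc)

text \<open>Stated without division, so that no denominator has to be non-zero. The induction step
  is the recurrence of \<open>\<alpha> ^ n - \<beta> ^ n\<close> in steps of two.\<close>

lemma lehmer_int_numerator:
  fixes \<alpha> \<beta> :: complex
  assumes "(\<alpha> + \<beta>)\<^sup>2 = of_int P" and "\<alpha> * \<beta> = of_int Q"
  shows "\<alpha> ^ n - \<beta> ^ n = of_int (lehmer_int P Q n) * (if odd n then \<alpha> - \<beta> else \<alpha>\<^sup>2 - \<beta>\<^sup>2)"
  using assms
proof (induction P Q n rule: lehmer_int.induct[case_names 0 1 2 3 step])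
  case (3 P Q)
  have "\<alpha> ^ 3 - \<beta> ^ 3 = ((\<alpha> + \<beta>)\<^sup>2 - \<alpha> * \<beta>) * (\<alpha> - \<beta>)" by algebra
  then show ?case unfolding 3 numeral_3_eq_3 by simp
next
  case (step P Q n)
  have n4: "Suc (Suc (Suc (Suc n))) = n + 4" by simp
  have "\<alpha> ^ (n + 4) - \<beta> ^ (n + 4) =
      ((\<alpha> + \<beta>)\<^sup>2 - 2 * (\<alpha> * \<beta>)) * (\<alpha> ^ (n + 2) - \<beta> ^ (n + 2)) - (\<alpha> * \<beta>)\<^sup>2 * (\<alpha> ^ n - \<beta> ^ n)"
    unfolding power_add by algebra
  also have "\<alpha> ^ (n + 2) - \<beta> ^ (n + 2) =
      of_int (lehmer_int P Q (n + 2)) * (if odd n then \<alpha> - \<beta> else \<alpha>\<^sup>2 - \<beta>\<^sup>2)"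
    using step.IH(1)[OF step.prems] by simp
  finally show ?case
    unfolding n4 step.prems step.IH(2)[OF step.prems] lehmer_int_add_4
    by (simp add: algebra_simps)
qed (auto simp: numeral_2_eq_2)

lemma lehmer_number_eq_lehmer_int:
  fixes \<alpha> \<beta> :: complex
  assumes P: "(\<alpha> + \<beta>)\<^sup>2 = of_int P" and Q: "\<alpha> * \<beta> = of_int Q" and "\<alpha>\<^sup>2 \<noteq> \<beta>\<^sup>2"
  shows "lehmer_number \<alpha> \<beta> n = of_int (lehmer_int P Q n)"
proof -
  have "\<alpha> \<noteq> \<beta>" using assms by auto
  then show ?thesis
    using \<open>\<alpha>\<^sup>2 \<noteq> \<beta>\<^sup>2\<close> unfolding lehmer_number_def lehmer_int_numerator[OF P Q, of n] by simp
qed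

text \<open>The integer conditions that are extracted from a defective pair. That \<alpha>/\<beta>
  is not a root of unity is reflected in \<open>P \<noteq> 4 * Q\<close> and in the non-vanishing of
  the Lehmer numbers; the product in the notion of primitive divisor is split into its factors, as
  \<open>r\<close> is prime.\<close>

definition defective_parameters :: "nat \<Rightarrow> int \<Rightarrow> int \<Rightarrow> bool" where
  "defective_parameters n P Q \<longleftrightarrow>
     P \<noteq> 0 \<and> Q \<noteq> 0 \<and> coprime P Q \<and> P \<noteq> 4 * Q \<and> (\<forall>j>0. lehmer_int P Q j \<noteq> 0) \<and>
     (\<forall>r::int. prime r \<longrightarrow> r dvd lehmer_int P Q n \<longrightarrow>
        r dvd P \<or> r dvd P - 4 * Q \<or> (\<exists>j\<in>{1..<n}. r dvd lehmer_int P Q j))"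

lemma int_dvd_of_int: "int_dvd r (of_int m) \<longleftrightarrow> int r dvd m"
  by (auto simp: int_dvd_def)

lemma defective_lehmer_pair_parameters:
  assumes "defective_lehmer_pair n \<alpha> \<beta>"
  obtains P Q where "(\<alpha> + \<beta>)\<^sup>2 = of_int P" "\<alpha> * \<beta> = of_int Q" "defective_parameters n P Q"
proof -
  from assms have lp: "lehmer_pair \<alpha> \<beta>" and np: "\<And>r. \<not> primitive_divisor r \<alpha> \<beta> n"
    by (auto simp: defective_lehmer_pair_def)
  from lp obtain P Q :: int where P: "(\<alpha> + \<beta>)\<^sup>2 = of_int P" and Q: "\<alpha> * \<beta> = of_int Q"
    and nz: "P \<noteq> 0" "Q \<noteq> 0" and cop: "coprime P Q"
    and nr: "\<And>m::nat. m > 0 \<Longrightarrow> (\<alpha> / \<beta>) ^ m \<noteq> 1"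
    unfolding lehmer_pair_def by blast
  have "\<beta> \<noteq> 0" using Q nz by auto
  then have pow: "\<alpha> ^ m \<noteq> \<beta> ^ m" if "m > 0" for m
    using nr[OF that] by (auto simp: power_divide)
  have sq: "\<alpha>\<^sup>2 \<noteq> \<beta>\<^sup>2" using pow[of 2] by simp
  note L = lehmer_number_eq_lehmer_int[OF P Q sq]
  have "(\<alpha>\<^sup>2 - \<beta>\<^sup>2)\<^sup>2 = (\<alpha> + \<beta>)\<^sup>2 * ((\<alpha> + \<beta>)\<^sup>2 - 4 * (\<alpha> * \<beta>))" by algebra
  then have disc: "(\<alpha>\<^sup>2 - \<beta>\<^sup>2)\<^sup>2 = of_int (P * (P - 4 * Q))" by (simp add: P Q)
  have "P \<noteq> 4 * Q"
  proof
    assume "P = 4 * Q"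
    then have "(\<alpha>\<^sup>2 - \<beta>\<^sup>2)\<^sup>2 = 0" using disc by simp
    then show False using sq by simp
  qed
  moreover have "lehmer_int P Q j \<noteq> 0" if "j > 0" for j
  proof
    assume "lehmer_int P Q j = 0"
    then have "\<alpha> ^ j - \<beta> ^ j = 0"
      using lehmer_int_numerator[OF P Q, of j] by simp
    then show False using pow[OF that] by simp
  qed
  moreover have "r dvd P \<or> r dvd P - 4 * Q \<or> (\<exists>j\<in>{1..<n}. r dvd lehmer_int P Q j)"
    if r: "prime r" "r dvd lehmer_int P Q n" for r :: int
  proof -
    define p where "p = nat r"
    then have r_eq: "r = int p" using prime_ge_0_int[OF r(1)] by simp
    then have p: "prime p" using r(1) by simp
    have eq: "(\<alpha>\<^sup>2 - \<beta>\<^sup>2)\<^sup>2 * (\<Prod>j\<in>{1..<n}. lehmer_number \<alpha> \<beta> j) =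
        of_int (P * (P - 4 * Q) * (\<Prod>j\<in>{1..<n}. lehmer_int P Q j))"
      by (simp only: disc L of_int_mult of_int_prod)
    have "r dvd P * (P - 4 * Q) * (\<Prod>j\<in>{1..<n}. lehmer_int P Q j)"
      using np[of p] p r(2) unfolding primitive_divisor_def eq unfolding L int_dvd_of_int r_eq by blast
    then show ?thesis
      unfolding prime_dvd_mult_iff[OF r(1)]
      using prime_dvd_prod_iff[OF _ r(1), of "{1..<n}"] by auto
  qed
  ultimately show thesis
    using that[OF P Q] nz cop unfolding defective_parameters_def by blast
qed

text \<open>For the indices of the theorem, the last factor is the homogeneous cyclotomic form
  \<Phi> of that index in \<alpha> and \<beta>, which later serves as \<open>F\<close>. The
  remaining indices occur as earlier Lehmer numbers.\<close>

lemma lehmer_int_values: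
  shows lehmer_int_1: "lehmer_int P Q 1 = 1"
    and lehmer_int_2: "lehmer_int P Q 2 = 1"
    and lehmer_int_3: "lehmer_int P Q 3 = P - Q"
    and lehmer_int_4: "lehmer_int P Q 4 = P - 2 * Q"
    and lehmer_int_5: "lehmer_int P Q 5 = P\<^sup>2 - 3 * P * Q + Q\<^sup>2"
    and lehmer_int_6: "lehmer_int P Q 6 = (P - Q) * (P - 3 * Q)"
    and lehmer_int_7: "lehmer_int P Q 7 = P ^ 3 - 5 * P\<^sup>2 * Q + 6 * P * Q\<^sup>2 - Q ^ 3"
    and lehmer_int_8: "lehmer_int P Q 8 = (P - 2 * Q) * (P\<^sup>2 - 4 * P * Q + 2 * Q\<^sup>2)"
    and lehmer_int_9: "lehmer_int P Q 9 = (P - Q) * (P ^ 3 - 6 * P\<^sup>2 * Q + 9 * P * Q\<^sup>2 - Q ^ 3)"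
    and lehmer_int_10: "lehmer_int P Q 10 = (P\<^sup>2 - 3 * P * Q + Q\<^sup>2) * (P\<^sup>2 - 5 * P * Q + 5 * Q\<^sup>2)"
    and lehmer_int_11: "lehmer_int P Q 11 = P ^ 5 - 9 * P ^ 4 * Q + 28 * P ^ 3 * Q\<^sup>2 - 35 * P\<^sup>2 * Q ^ 3 + 15 * P * Q ^ 4 - Q ^ 5"
    and lehmer_int_12: "lehmer_int P Q 12 = (P - Q) * (P - 3 * Q) * (P - 2 * Q) * (P\<^sup>2 - 4 * P * Q + Q\<^sup>2)"
proof -
  have step: "lehmer_int P Q m = (P - 2 * Q) * lehmer_int P Q k - Q\<^sup>2 * lehmer_int P Q n"
    if "m = n + 4" "k = n + 2" for m k n
    using that lehmer_int_add_4 by simp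
  show 1: "lehmer_int P Q 1 = 1" and 2: "lehmer_int P Q 2 = 1" and 3: "lehmer_int P Q 3 = P - Q"
    by (simp_all add: numeral_2_eq_2 numeral_3_eq_3)
  show 4: "lehmer_int P Q 4 = P - 2 * Q"
    using step[of 4 0 2] unfolding 2 by simp
  have "lehmer_int P Q 5 = (P - 2 * Q) * lehmer_int P Q 3 - Q\<^sup>2 * lehmer_int P Q 1"
    by (rule step) simp_all
  also have "\<dots> = P\<^sup>2 - 3 * P * Q + Q\<^sup>2"
    unfolding 3 1 by algebra
  finally show 5: "lehmer_int P Q 5 = P\<^sup>2 - 3 * P * Q + Q\<^sup>2" .
  have "lehmer_int P Q 6 = (P - 2 * Q) * lehmer_int P Q 4 - Q\<^sup>2 * lehmer_int P Q 2"
    by (rule step) simp_all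
  also have "\<dots> = (P - Q) * (P - 3 * Q)"
    unfolding 4 2 by algebra
  finally show 6: "lehmer_int P Q 6 = (P - Q) * (P - 3 * Q)" .
  have "lehmer_int P Q 7 = (P - 2 * Q) * lehmer_int P Q 5 - Q\<^sup>2 * lehmer_int P Q 3"
    by (rule step) simp_all
  also have "\<dots> = P ^ 3 - 5 * P\<^sup>2 * Q + 6 * P * Q\<^sup>2 - Q ^ 3"
    unfolding 5 3 by algebra
  finally show 7: "lehmer_int P Q 7 = P ^ 3 - 5 * P\<^sup>2 * Q + 6 * P * Q\<^sup>2 - Q ^ 3" .
  have "lehmer_int P Q 8 = (P - 2 * Q) * lehmer_int P Q 6 - Q\<^sup>2 * lehmer_int P Q 4"
    by (rule step) simp_all
  also have "\<dots> = (P - 2 * Q) * (P\<^sup>2 - 4 * P * Q + 2 * Q\<^sup>2)"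
    unfolding 6 4 by algebra
  finally show 8: "lehmer_int P Q 8 = (P - 2 * Q) * (P\<^sup>2 - 4 * P * Q + 2 * Q\<^sup>2)" .
  have "lehmer_int P Q 9 = (P - 2 * Q) * lehmer_int P Q 7 - Q\<^sup>2 * lehmer_int P Q 5"
    by (rule step) simp_all
  also have "\<dots> = (P - Q) * (P ^ 3 - 6 * P\<^sup>2 * Q + 9 * P * Q\<^sup>2 - Q ^ 3)"
    unfolding 7 5 by algebra
  finally show 9: "lehmer_int P Q 9 = (P - Q) * (P ^ 3 - 6 * P\<^sup>2 * Q + 9 * P * Q\<^sup>2 - Q ^ 3)" .
  have "lehmer_int P Q 10 = (P - 2 * Q) * lehmer_int P Q 8 - Q\<^sup>2 * lehmer_int P Q 6"
    by (rule step) simp_all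
  also have "\<dots> = (P\<^sup>2 - 3 * P * Q + Q\<^sup>2) * (P\<^sup>2 - 5 * P * Q + 5 * Q\<^sup>2)"
    unfolding 8 6 by algebra
  finally show 10: "lehmer_int P Q 10 = (P\<^sup>2 - 3 * P * Q + Q\<^sup>2) * (P\<^sup>2 - 5 * P * Q + 5 * Q\<^sup>2)" .
  have "lehmer_int P Q 11 = (P - 2 * Q) * lehmer_int P Q 9 - Q\<^sup>2 * lehmer_int P Q 7"
    by (rule step) simp_all
  also have "\<dots> = P ^ 5 - 9 * P ^ 4 * Q + 28 * P ^ 3 * Q\<^sup>2 - 35 * P\<^sup>2 * Q ^ 3 + 15 * P * Q ^ 4 - Q ^ 5"
    unfolding 9 7 by algebra
  finally show 11: "lehmer_int P Q 11 = P ^ 5 - 9 * P ^ 4 * Q + 28 * P ^ 3 * Q\<^sup>2 - 35 * P\<^sup>2 * Q ^ 3 + 15 * P * Q ^ 4 - Q ^ 5" .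
  have "lehmer_int P Q 12 = (P - 2 * Q) * lehmer_int P Q 10 - Q\<^sup>2 * lehmer_int P Q 8"
    by (rule step) simp_all
  also have "\<dots> = (P - Q) * (P - 3 * Q) * (P - 2 * Q) * (P\<^sup>2 - 4 * P * Q + Q\<^sup>2)"
    unfolding 10 8 by algebra
  finally show 12: "lehmer_int P Q 12 = (P - Q) * (P - 3 * Q) * (P - 2 * Q) * (P\<^sup>2 - 4 * P * Q + Q\<^sup>2)" .
qed

section \<open>Primes dividing the primitive part\<close>

text \<open>\<open>F\<close> and \<open>X\<close> are meant to be forms in \<open>P\<close> and
  \<open>Q\<close>. Eliminating \<open>P\<close> from two homogeneous forms leaves a constant times
  a power of \<open>Q\<close>, hence the factor \<open>Q ^ m\<close>.\<close>

definition bezout_multiple :: "int \<Rightarrow> int \<Rightarrow> int \<Rightarrow> int \<Rightarrow> bool" where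
  "bezout_multiple c Q F X \<longleftrightarrow> (\<exists>A B m. c * Q ^ m = A * F + B * X)"

lemma bezout_multipleI: "c * Q ^ m = A * F + B * X \<Longrightarrow> bezout_multiple c Q F X"
  by (auto simp: bezout_multiple_def)

lemma prime_dvd_bezout_multiple:
  fixes r :: int
  assumes "prime r" "r dvd F" "r dvd X" "\<not> r dvd Q" "bezout_multiple c Q F X"
  shows "r dvd c"
proof -
  from assms(5) obtain A B m where "c * Q ^ m = A * F + B * X"
    by (auto simp: bezout_multiple_def)
  then have "r dvd c * Q ^ m"
    using assms(2,3) by simp
  then show ?thesis
    using assms(1,4) by (auto simp: prime_dvd_mult_iff dest: prime_dvd_power)
qed

text \<open>By the shape \<open>P ^ e + Q * K\<close>, a prime dividing both \<open>F\<close> and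
  \<open>Q\<close> would divide \<open>P\<close>, against coprimality. So \<open>r\<close> does not
  divide \<open>Q\<close>, and in each alternative offered by defectiveness the matching Bezout
  identity leaves \<open>r dvd c\<close>. One constant \<open>c\<close> has to serve all
  alternatives.\<close>

lemma defective_prime_dvd:
  fixes r :: int
  assumes def: "defective_parameters n P Q" and r: "prime r" "r dvd F"
    and F: "F dvd lehmer_int P Q n" "F = P ^ e + Q * K"
    and P: "bezout_multiple c Q F P" and D: "bezout_multiple c Q F (P - 4 * Q)"
    and L: "\<And>j. j \<in> {1..<n} \<Longrightarrow> bezout_multiple c Q F (lehmer_int P Q j)"
  shows "r dvd c"
proof -
  have nQ: "\<not> r dvd Q"
  proof
    assume "r dvd Q"
    moreover from this have "r dvd P ^ e"
      using r(2) unfolding F(2) by (simp add: dvd_add_left_iff)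
    then have "r dvd P"
      using r(1) by (rule prime_dvd_power[rotated])
    ultimately have "is_unit r"
      using def coprime_common_divisor[of P Q r] by (auto simp: defective_parameters_def)
    then show False using r(1) by (simp add: not_prime_unit)
  qed
  have "r dvd lehmer_int P Q n"
    using r(2) F(1) by (rule dvd_trans)
  then have "r dvd P \<or> r dvd P - 4 * Q \<or> (\<exists>j\<in>{1..<n}. r dvd lehmer_int P Q j)"
    using def r(1) unfolding defective_parameters_def by blast
  then show ?thesis
    using prime_dvd_bezout_multiple[OF r _ nQ] P D L by blast
qed

section \<open>Bezout identities for each index\<close>

text \<open>The constant 3 comes from \<open>P - 4 * Q\<close>; the other identities hold with
  constant 1 and are scaled by 3. The lemmas for the other indices scale to a common constant in the
  same way.\<close>

lemma defective_3_prime_dvd: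
  fixes r :: int
  assumes "defective_parameters 3 P Q" "prime r" "r dvd P - Q"
  shows "r dvd 3"
proof (rule defective_prime_dvd[OF assms])
  show "P - Q dvd lehmer_int P Q 3"
    by (simp add: lehmer_int_values)
  show "P - Q = P ^ 1 + Q * (-1)"
    by algebra
  show "bezout_multiple 3 Q (P - Q) P"
    by (rule bezout_multipleI[of _ _ 1 "- 3" _ "3"]) algebra
  show "bezout_multiple 3 Q (P - Q) (P - 4 * Q)"
    by (rule bezout_multipleI[of _ _ 1 "1" _ "- 1"]) algebra
next
  have b1: "bezout_multiple 3 Q (P - Q) (lehmer_int P Q 1)"
    unfolding lehmer_int_1 by (rule bezout_multipleI[of _ _ 0 "0" _ "3"]) algebra
  have b2: "bezout_multiple 3 Q (P - Q) (lehmer_int P Q 2)"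
    unfolding lehmer_int_2 by (rule bezout_multipleI[of _ _ 0 "0" _ "3"]) algebra
  fix j :: nat
  assume "j \<in> {1..<3}"
  then have "j = 1 \<or> j = 2"
    unfolding atLeastLessThan_iff by presburger
  then show "bezout_multiple 3 Q (P - Q) (lehmer_int P Q j)"
    by (elim disjE) (simp_all only: b1 b2)
qed

lemma defective_4_prime_dvd:
  fixes r :: int
  assumes "defective_parameters 4 P Q" "prime r" "r dvd P - 2 * Q"
  shows "r dvd 2"
proof (rule defective_prime_dvd[OF assms])
  show "P - 2 * Q dvd lehmer_int P Q 4"
    by (simp add: lehmer_int_values)
  show "P - 2 * Q = P ^ 1 + Q * (-2)"
    by algebra
  show "bezout_multiple 2 Q (P - 2 * Q) P"
    by (rule bezout_multipleI[of _ _ 1 "- 1" _ "1"]) algebra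
  show "bezout_multiple 2 Q (P - 2 * Q) (P - 4 * Q)"
    by (rule bezout_multipleI[of _ _ 1 "1" _ "- 1"]) algebra
next
  have b1: "bezout_multiple 2 Q (P - 2 * Q) (lehmer_int P Q 1)"
    unfolding lehmer_int_1 by (rule bezout_multipleI[of _ _ 0 "0" _ "2"]) algebra
  have b2: "bezout_multiple 2 Q (P - 2 * Q) (lehmer_int P Q 2)"
    unfolding lehmer_int_2 by (rule bezout_multipleI[of _ _ 0 "0" _ "2"]) algebra
  have b3: "bezout_multiple 2 Q (P - 2 * Q) (lehmer_int P Q 3)"
    unfolding lehmer_int_3 by (rule bezout_multipleI[of _ _ 1 "- 2" _ "2"]) algebra
  fix j :: nat
  assume "j \<in> {1..<4}"
  then have "j = 1 \<or> j = 2 \<or> j = 3"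
    unfolding atLeastLessThan_iff by presburger
  then show "bezout_multiple 2 Q (P - 2 * Q) (lehmer_int P Q j)"
    by (elim disjE) (simp_all only: b1 b2 b3)
qed

text \<open>The constant 5 comes from \<open>P - 4 * Q\<close>, through
  \<open>F - (P + Q) * (P - 4 * Q) = 5 * Q\<^sup>2\<close>.\<close>

lemma defective_5_prime_dvd:
  fixes r :: int
  assumes "defective_parameters 5 P Q" "prime r" "r dvd P\<^sup>2 - 3 * P * Q + Q\<^sup>2"
  shows "r dvd 5"
proof (rule defective_prime_dvd[OF assms])
  show "P\<^sup>2 - 3 * P * Q + Q\<^sup>2 dvd lehmer_int P Q 5"
    by (simp add: lehmer_int_values)
  show "P\<^sup>2 - 3 * P * Q + Q\<^sup>2 = P ^ 2 + Q * (Q - 3 * P)"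
    by algebra
  show "bezout_multiple 5 Q (P\<^sup>2 - 3 * P * Q + Q\<^sup>2) P"
    by (rule bezout_multipleI[of _ _ 2 "5" _ "- 5 * P + 15 * Q"]) algebra
  show "bezout_multiple 5 Q (P\<^sup>2 - 3 * P * Q + Q\<^sup>2) (P - 4 * Q)"
    by (rule bezout_multipleI[of _ _ 2 "1" _ "- P - Q"]) algebra
next
  have b1: "bezout_multiple 5 Q (P\<^sup>2 - 3 * P * Q + Q\<^sup>2) (lehmer_int P Q 1)"
    unfolding lehmer_int_1 by (rule bezout_multipleI[of _ _ 0 "0" _ "5"]) algebra
  have b2: "bezout_multiple 5 Q (P\<^sup>2 - 3 * P * Q + Q\<^sup>2) (lehmer_int P Q 2)"
    unfolding lehmer_int_2 by (rule bezout_multipleI[of _ _ 0 "0" _ "5"]) algebra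
  have b3: "bezout_multiple 5 Q (P\<^sup>2 - 3 * P * Q + Q\<^sup>2) (lehmer_int P Q 3)"
    unfolding lehmer_int_3 by (rule bezout_multipleI[of _ _ 2 "- 5" _ "5 * P - 10 * Q"]) algebra
  have b4: "bezout_multiple 5 Q (P\<^sup>2 - 3 * P * Q + Q\<^sup>2) (lehmer_int P Q 4)"
    unfolding lehmer_int_4 by (rule bezout_multipleI[of _ _ 2 "- 5" _ "5 * P - 5 * Q"]) algebra
  fix j :: nat
  assume "j \<in> {1..<5}"
  then have "j = 1 \<or> j = 2 \<or> j = 3 \<or> j = 4"
    unfolding atLeastLessThan_iff by presburger
  then show "bezout_multiple 5 Q (P\<^sup>2 - 3 * P * Q + Q\<^sup>2) (lehmer_int P Q j)"
    by (elim disjE) (simp_all only: b1 b2 b3 b4)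
qed

text \<open>The factor 3 of the constant comes from \<open>P\<close>, the factor 2 from the Lehmer
  number \<open>P - Q\<close> of index 3.\<close>

lemma defective_6_prime_dvd:
  fixes r :: int
  assumes "defective_parameters 6 P Q" "prime r" "r dvd P - 3 * Q"
  shows "r dvd 6"
proof (rule defective_prime_dvd[OF assms])
  show "P - 3 * Q dvd lehmer_int P Q 6"
    by (simp add: lehmer_int_values)
  show "P - 3 * Q = P ^ 1 + Q * (-3)"
    by algebra
  show "bezout_multiple 6 Q (P - 3 * Q) P"
    by (rule bezout_multipleI[of _ _ 1 "- 2" _ "2"]) algebra
  show "bezout_multiple 6 Q (P - 3 * Q) (P - 4 * Q)"
    by (rule bezout_multipleI[of _ _ 1 "6" _ "- 6"]) algebra
next
  have b1: "bezout_multiple 6 Q (P - 3 * Q) (lehmer_int P Q 1)"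
    unfolding lehmer_int_1 by (rule bezout_multipleI[of _ _ 0 "0" _ "6"]) algebra
  have b2: "bezout_multiple 6 Q (P - 3 * Q) (lehmer_int P Q 2)"
    unfolding lehmer_int_2 by (rule bezout_multipleI[of _ _ 0 "0" _ "6"]) algebra
  have b3: "bezout_multiple 6 Q (P - 3 * Q) (lehmer_int P Q 3)"
    unfolding lehmer_int_3 by (rule bezout_multipleI[of _ _ 1 "- 3" _ "3"]) algebra
  have b4: "bezout_multiple 6 Q (P - 3 * Q) (lehmer_int P Q 4)"
    unfolding lehmer_int_4 by (rule bezout_multipleI[of _ _ 1 "- 6" _ "6"]) algebra
  have b5: "bezout_multiple 6 Q (P - 3 * Q) (lehmer_int P Q 5)"
    unfolding lehmer_int_5 by (rule bezout_multipleI[of _ _ 2 "- 6 * P" _ "6"]) algebra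
  fix j :: nat
  assume "j \<in> {1..<6}"
  then have "j = 1 \<or> j = 2 \<or> j = 3 \<or> j = 4 \<or> j = 5"
    unfolding atLeastLessThan_iff by presburger
  then show "bezout_multiple 6 Q (P - 3 * Q) (lehmer_int P Q j)"
    by (elim disjE) (simp_all only: b1 b2 b3 b4 b5)
qed

lemma defective_8_prime_dvd:
  fixes r :: int
  assumes "defective_parameters 8 P Q" "prime r" "r dvd P\<^sup>2 - 4 * P * Q + 2 * Q\<^sup>2"
  shows "r dvd 2"
proof (rule defective_prime_dvd[OF assms])
  show "P\<^sup>2 - 4 * P * Q + 2 * Q\<^sup>2 dvd lehmer_int P Q 8"
    by (simp add: lehmer_int_values)
  show "P\<^sup>2 - 4 * P * Q + 2 * Q\<^sup>2 = P ^ 2 + Q * (2 * Q - 4 * P)"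
    by algebra
  show "bezout_multiple 2 Q (P\<^sup>2 - 4 * P * Q + 2 * Q\<^sup>2) P"
    by (rule bezout_multipleI[of _ _ 2 "1" _ "- P + 4 * Q"]) algebra
  show "bezout_multiple 2 Q (P\<^sup>2 - 4 * P * Q + 2 * Q\<^sup>2) (P - 4 * Q)"
    by (rule bezout_multipleI[of _ _ 2 "1" _ "- P"]) algebra
next
  have b1: "bezout_multiple 2 Q (P\<^sup>2 - 4 * P * Q + 2 * Q\<^sup>2) (lehmer_int P Q 1)"
    unfolding lehmer_int_1 by (rule bezout_multipleI[of _ _ 0 "0" _ "2"]) algebra
  have b2: "bezout_multiple 2 Q (P\<^sup>2 - 4 * P * Q + 2 * Q\<^sup>2) (lehmer_int P Q 2)"
    unfolding lehmer_int_2 by (rule bezout_multipleI[of _ _ 0 "0" _ "2"]) algebra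
  have b3: "bezout_multiple 2 Q (P\<^sup>2 - 4 * P * Q + 2 * Q\<^sup>2) (lehmer_int P Q 3)"
    unfolding lehmer_int_3 by (rule bezout_multipleI[of _ _ 2 "- 2" _ "2 * P - 6 * Q"]) algebra
  have b4: "bezout_multiple 2 Q (P\<^sup>2 - 4 * P * Q + 2 * Q\<^sup>2) (lehmer_int P Q 4)"
    unfolding lehmer_int_4 by (rule bezout_multipleI[of _ _ 2 "- 1" _ "P - 2 * Q"]) algebra
  have b5: "bezout_multiple 2 Q (P\<^sup>2 - 4 * P * Q + 2 * Q\<^sup>2) (lehmer_int P Q 5)"
    unfolding lehmer_int_5 by (rule bezout_multipleI[of _ _ 3 "- 2 * P + 4 * Q" _ "2 * P - 6 * Q"]) algebra
  have b6: "bezout_multiple 2 Q (P\<^sup>2 - 4 * P * Q + 2 * Q\<^sup>2) (lehmer_int P Q 6)"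
    unfolding lehmer_int_6 by (rule bezout_multipleI[of _ _ 2 "- 2" _ "2"]) algebra
  have b7: "bezout_multiple 2 Q (P\<^sup>2 - 4 * P * Q + 2 * Q\<^sup>2) (lehmer_int P Q 7)"
    unfolding lehmer_int_7 by (rule bezout_multipleI[of _ _ 3 "- 2 * P + 2 * Q" _ "2"]) algebra
  fix j :: nat
  assume "j \<in> {1..<8}"
  then have "j = 1 \<or> j = 2 \<or> j = 3 \<or> j = 4 \<or> j = 5 \<or> j = 6 \<or> j = 7"
    unfolding atLeastLessThan_iff by presburger
  then show "bezout_multiple 2 Q (P\<^sup>2 - 4 * P * Q + 2 * Q\<^sup>2) (lehmer_int P Q j)"
    by (elim disjE) (simp_all only: b1 b2 b3 b4 b5 b6 b7)
qed

text \<open>The prime 5 comes from \<open>P\<close> and the prime 2 from the Lehmer number of index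
  5. The prime 2 is ruled out by parity in the classification.\<close>

lemma defective_10_prime_dvd:
  fixes r :: int
  assumes "defective_parameters 10 P Q" "prime r" "r dvd P\<^sup>2 - 5 * P * Q + 5 * Q\<^sup>2"
  shows "r dvd 20"
proof (rule defective_prime_dvd[OF assms])
  show "P\<^sup>2 - 5 * P * Q + 5 * Q\<^sup>2 dvd lehmer_int P Q 10"
    by (simp add: lehmer_int_values)
  show "P\<^sup>2 - 5 * P * Q + 5 * Q\<^sup>2 = P ^ 2 + Q * (5 * Q - 5 * P)"
    by algebra
  show "bezout_multiple 20 Q (P\<^sup>2 - 5 * P * Q + 5 * Q\<^sup>2) P"
    by (rule bezout_multipleI[of _ _ 2 "4" _ "- 4 * P + 20 * Q"]) algebra
  show "bezout_multiple 20 Q (P\<^sup>2 - 5 * P * Q + 5 * Q\<^sup>2) (P - 4 * Q)"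
    by (rule bezout_multipleI[of _ _ 2 "20" _ "- 20 * P + 20 * Q"]) algebra
next
  have b1: "bezout_multiple 20 Q (P\<^sup>2 - 5 * P * Q + 5 * Q\<^sup>2) (lehmer_int P Q 1)"
    unfolding lehmer_int_1 by (rule bezout_multipleI[of _ _ 0 "0" _ "20"]) algebra
  have b2: "bezout_multiple 20 Q (P\<^sup>2 - 5 * P * Q + 5 * Q\<^sup>2) (lehmer_int P Q 2)"
    unfolding lehmer_int_2 by (rule bezout_multipleI[of _ _ 0 "0" _ "20"]) algebra
  have b3: "bezout_multiple 20 Q (P\<^sup>2 - 5 * P * Q + 5 * Q\<^sup>2) (lehmer_int P Q 3)"
    unfolding lehmer_int_3 by (rule bezout_multipleI[of _ _ 2 "20" _ "- 20 * P + 80 * Q"]) algebra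
  have b4: "bezout_multiple 20 Q (P\<^sup>2 - 5 * P * Q + 5 * Q\<^sup>2) (lehmer_int P Q 4)"
    unfolding lehmer_int_4 by (rule bezout_multipleI[of _ _ 2 "- 20" _ "20 * P - 60 * Q"]) algebra
  have b5: "bezout_multiple 20 Q (P\<^sup>2 - 5 * P * Q + 5 * Q\<^sup>2) (lehmer_int P Q 5)"
    unfolding lehmer_int_5 by (rule bezout_multipleI[of _ _ 3 "- 10 * P + 10 * Q" _ "10 * P - 30 * Q"]) algebra
  have b6: "bezout_multiple 20 Q (P\<^sup>2 - 5 * P * Q + 5 * Q\<^sup>2) (lehmer_int P Q 6)"
    unfolding lehmer_int_6 by (rule bezout_multipleI[of _ _ 3 "- 20 * P + 40 * Q" _ "20 * P - 60 * Q"]) algebra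
  have b7: "bezout_multiple 20 Q (P\<^sup>2 - 5 * P * Q + 5 * Q\<^sup>2) (lehmer_int P Q 7)"
    unfolding lehmer_int_7 by (rule bezout_multipleI[of _ _ 4 "20 * P\<^sup>2 - 80 * P * Q + 20 * Q\<^sup>2" _ "- 20 * P + 80 * Q"]) algebra
  have b8: "bezout_multiple 20 Q (P\<^sup>2 - 5 * P * Q + 5 * Q\<^sup>2) (lehmer_int P Q 8)"
    unfolding lehmer_int_8 by (rule bezout_multipleI[of _ _ 3 "- 20 * P + 20 * Q" _ "20"]) algebra
  have b9: "bezout_multiple 20 Q (P\<^sup>2 - 5 * P * Q + 5 * Q\<^sup>2) (lehmer_int P Q 9)"
    unfolding lehmer_int_9 by (rule bezout_multipleI[of _ _ 4 "- 20 * P\<^sup>2 + 40 * P * Q" _ "20"]) algebra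
  fix j :: nat
  assume "j \<in> {1..<10}"
  then have "j = 1 \<or> j = 2 \<or> j = 3 \<or> j = 4 \<or> j = 5 \<or> j = 6 \<or> j = 7 \<or> j = 8 \<or> j = 9"
    unfolding atLeastLessThan_iff by presburger
  then show "bezout_multiple 20 Q (P\<^sup>2 - 5 * P * Q + 5 * Q\<^sup>2) (lehmer_int P Q j)"
    by (elim disjE) (simp_all only: b1 b2 b3 b4 b5 b6 b7 b8 b9)
qed

text \<open>The prime 2 comes from the Lehmer numbers of index 3, 6 and 9, the prime 3 from those of
  index 4 and 8.\<close>

lemma defective_12_prime_dvd:
  fixes r :: int
  assumes "defective_parameters 12 P Q" "prime r" "r dvd P\<^sup>2 - 4 * P * Q + Q\<^sup>2"
  shows "r dvd 6"
proof (rule defective_prime_dvd[OF assms])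
  show "P\<^sup>2 - 4 * P * Q + Q\<^sup>2 dvd lehmer_int P Q 12"
    by (simp add: lehmer_int_values)
  show "P\<^sup>2 - 4 * P * Q + Q\<^sup>2 = P ^ 2 + Q * (Q - 4 * P)"
    by algebra
  show "bezout_multiple 6 Q (P\<^sup>2 - 4 * P * Q + Q\<^sup>2) P"
    by (rule bezout_multipleI[of _ _ 2 "6" _ "- 6 * P + 24 * Q"]) algebra
  show "bezout_multiple 6 Q (P\<^sup>2 - 4 * P * Q + Q\<^sup>2) (P - 4 * Q)"
    by (rule bezout_multipleI[of _ _ 2 "6" _ "- 6 * P"]) algebra
next
  have b1: "bezout_multiple 6 Q (P\<^sup>2 - 4 * P * Q + Q\<^sup>2) (lehmer_int P Q 1)"
    unfolding lehmer_int_1 by (rule bezout_multipleI[of _ _ 0 "0" _ "6"]) algebra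
  have b2: "bezout_multiple 6 Q (P\<^sup>2 - 4 * P * Q + Q\<^sup>2) (lehmer_int P Q 2)"
    unfolding lehmer_int_2 by (rule bezout_multipleI[of _ _ 0 "0" _ "6"]) algebra
  have b3: "bezout_multiple 6 Q (P\<^sup>2 - 4 * P * Q + Q\<^sup>2) (lehmer_int P Q 3)"
    unfolding lehmer_int_3 by (rule bezout_multipleI[of _ _ 2 "- 3" _ "3 * P - 9 * Q"]) algebra
  have b4: "bezout_multiple 6 Q (P\<^sup>2 - 4 * P * Q + Q\<^sup>2) (lehmer_int P Q 4)"
    unfolding lehmer_int_4 by (rule bezout_multipleI[of _ _ 2 "- 2" _ "2 * P - 4 * Q"]) algebra
  have b5: "bezout_multiple 6 Q (P\<^sup>2 - 4 * P * Q + Q\<^sup>2) (lehmer_int P Q 5)"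
    unfolding lehmer_int_5 by (rule bezout_multipleI[of _ _ 3 "6 * P - 18 * Q" _ "- 6 * P + 24 * Q"]) algebra
  have b6: "bezout_multiple 6 Q (P\<^sup>2 - 4 * P * Q + Q\<^sup>2) (lehmer_int P Q 6)"
    unfolding lehmer_int_6 by (rule bezout_multipleI[of _ _ 2 "- 3" _ "3"]) algebra
  have b7: "bezout_multiple 6 Q (P\<^sup>2 - 4 * P * Q + Q\<^sup>2) (lehmer_int P Q 7)"
    unfolding lehmer_int_7 by (rule bezout_multipleI[of _ _ 4 "6 * P\<^sup>2 - 30 * P * Q + 30 * Q\<^sup>2" _ "- 6 * P + 24 * Q"]) algebra
  have b8: "bezout_multiple 6 Q (P\<^sup>2 - 4 * P * Q + Q\<^sup>2) (lehmer_int P Q 8)"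
    unfolding lehmer_int_8 by (rule bezout_multipleI[of _ _ 4 "- 2 * P\<^sup>2 + 8 * P * Q - 10 * Q\<^sup>2" _ "2 * P - 4 * Q"]) algebra
  have b9: "bezout_multiple 6 Q (P\<^sup>2 - 4 * P * Q + Q\<^sup>2) (lehmer_int P Q 9)"
    unfolding lehmer_int_9 by (rule bezout_multipleI[of _ _ 5 "- 3 * P ^ 3 + 18 * P\<^sup>2 * Q - 33 * P * Q\<^sup>2 + 15 * Q ^ 3" _ "3 * P - 9 * Q"]) algebra
  have b10: "bezout_multiple 6 Q (P\<^sup>2 - 4 * P * Q + Q\<^sup>2) (lehmer_int P Q 10)"
    unfolding lehmer_int_10 by (rule bezout_multipleI[of _ _ 4 "- 6 * P\<^sup>2 + 24 * P * Q - 24 * Q\<^sup>2" _ "6"]) algebra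
  have b11: "bezout_multiple 6 Q (P\<^sup>2 - 4 * P * Q + Q\<^sup>2) (lehmer_int P Q 11)"
    unfolding lehmer_int_11 by (rule bezout_multipleI[of _ _ 5 "- 6 * P ^ 3 + 30 * P\<^sup>2 * Q - 42 * P * Q\<^sup>2 + 12 * Q ^ 3" _ "6"]) algebra
  fix j :: nat
  assume "j \<in> {1..<12}"
  then have "j = 1 \<or> j = 2 \<or> j = 3 \<or> j = 4 \<or> j = 5 \<or> j = 6 \<or> j = 7 \<or> j = 8 \<or> j = 9 \<or> j = 10 \<or> j = 11"
    unfolding atLeastLessThan_iff by presburger
  then show "bezout_multiple 6 Q (P\<^sup>2 - 4 * P * Q + Q\<^sup>2) (lehmer_int P Q j)"
    by (elim disjE) (simp_all only: b1 b2 b3 b4 b5 b6 b7 b8 b9 b10 b11)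
qed


section \<open>Integers with few prime factors\<close>

lemma prime_int_dvd_imp_eq: "p = q" if "prime p" "prime q" "p dvd q" for p q :: int
  using that primes_dvd_imp_eq by blast

text \<open>Strong induction on the absolute value, splitting off one prime at a time. The case
  \<open>p = q\<close> is allowed and covers the indices at which a single prime remains.\<close>

lemma int_two_primes:
  fixes m p q :: int
  assumes "m \<noteq> 0" and "\<And>r. prime r \<Longrightarrow> r dvd m \<Longrightarrow> r = p \<or> r = q"
  obtains i j where "\<bar>m\<bar> = p ^ i * q ^ j"
  using assms
proof (induction "nat \<bar>m\<bar>" arbitrary: m thesis rule: less_induct)
  case less
  show thesis
  proof (cases "is_unit m")
    case True
    then show thesis using less.prems(1)[of 0 0] by simp
  next
    case False
    then obtain r where r: "prime r" "r dvd m"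
      using prime_divisor_exists less.prems(2) by blast
    then obtain m' where m': "m = r * m'" by blast
    have "m' \<noteq> 0" "1 < r" using less.prems(2) m' r(1) by (auto dest: prime_gt_1_int)
    then have lt: "nat \<bar>m'\<bar> < nat \<bar>m\<bar>"
      by (simp add: m' abs_mult nat_mult_distrib)
    obtain i j where ij: "\<bar>m'\<bar> = p ^ i * q ^ j"
      using less.hyps[OF lt _ \<open>m' \<noteq> 0\<close>] less.prems(3) m' by (metis dvd_mult)
    have "\<bar>m\<bar> = p ^ Suc i * q ^ j" if "r = p"
      using ij that \<open>1 < r\<close> by (simp add: m' abs_mult)
    moreover have "\<bar>m\<bar> = p ^ i * q ^ Suc j" if "r = q"
      using ij that \<open>1 < r\<close> by (simp add: m' abs_mult)
    ultimately show thesis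
      using less.prems(1) less.prems(3)[OF r] by blast
  qed
qed

text \<open>Each exponent is at most 1. For \<open>p = q\<close> the value \<open>p * q\<close> is
  still among the candidates, and the applications exclude it separately.\<close>

lemma int_squarefree_two_primes:
  fixes m p q :: int
  assumes "m \<noteq> 0" "\<And>r. prime r \<Longrightarrow> r dvd m \<Longrightarrow> r = p \<or> r = q"
    and "\<not> p\<^sup>2 dvd m" "\<not> q\<^sup>2 dvd m"
  shows "\<bar>m\<bar> \<in> {1, p, q, p * q}"
proof -
  obtain i j where m: "\<bar>m\<bar> = p ^ i * q ^ j"
    using int_two_primes assms(1,2) by blast
  have "i < 2"
  proof (rule ccontr)
    assume "\<not> i < 2"
    then have "p\<^sup>2 dvd \<bar>m\<bar>" unfolding m by (simp add: le_imp_power_dvd)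
    then show False using assms(3) by simp
  qed
  moreover have "j < 2"
  proof (rule ccontr)
    assume "\<not> j < 2"
    then have "q\<^sup>2 dvd \<bar>m\<bar>" unfolding m by (simp add: le_imp_power_dvd)
    then show False using assms(4) by simp
  qed
  ultimately show ?thesis
    using m by (auto simp: less_2_cases_iff)
qed

lemma prime_dvd_2: "r = 2" if "prime r" "r dvd 2" for r :: int
  using that prime_int_dvd_imp_eq[of r 2] by simp

lemma prime_dvd_3: "r = 3" if "prime r" "r dvd 3" for r :: int
  using that prime_int_dvd_imp_eq[of r 3] by simp

lemma prime_dvd_5: "r = 5" if "prime r" "r dvd 5" for r :: int
  using that prime_int_dvd_imp_eq[of r 5] by simp

lemma prime_dvd_6: "r = 2 \<or> r = 3" if "prime r" "r dvd 6" for r :: int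
proof -
  have "r dvd 2 * 3" using that(2) by simp
  then show ?thesis
    using that(1) prime_dvd_2 prime_dvd_3 prime_dvd_mult_iff by blast
qed

lemma prime_dvd_20: "r = 2 \<or> r = 5" if "prime r" "r dvd 20" for r :: int
proof -
  have "r dvd 2 * (2 * 5)" using that(2) by simp
  then show ?thesis
    using that(1) prime_dvd_2 prime_dvd_5 prime_dvd_mult_iff by blast
qed

section \<open>Linear relations between the sequences\<close>

text \<open>In terms of \<open>(\<psi> k + \<phi> k * sqrt 5) / 2\<close>, this is multiplication by
  the unit \<open>(1 + sqrt 5) / 2\<close>. It connects the sequences with the descent on the Pell
  equation.\<close>

lemma fib_luc_Suc:
  assumes "k \<ge> -2"
  shows "2 * \<phi> (k + 1) = \<phi> k + \<psi> k \<and> 2 * \<psi> (k + 1) = 5 * \<phi> k + \<psi> k"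
  using assms
proof (induction k rule: int_ge_induct)
  case base
  then show ?case by (simp add: seq_initial_values)
next
  case (step k)
  then show ?case
    using fib_seq_rec[of k] luc_seq_rec[of k] by (auto simp: algebra_simps)
qed

text \<open>Multiplication by the square of that unit and by its inverse. These right-hand sides
  arise when \<open>2 * X - 3 * Y\<close> is solved for \<open>X\<close>.\<close>

lemma fib_luc_shift_2:
  assumes "k \<ge> 0"
  shows "2 * \<phi> (k + 2) = 3 * \<phi> k + \<psi> k" "2 * \<phi> (k - 2) = 3 * \<phi> k - \<psi> k"
    "2 * \<psi> (k + 2) = 3 * \<psi> k + 5 * \<phi> k" "2 * \<psi> (k - 2) = 3 * \<psi> k - 5 * \<phi> k"
  using fib_luc_Suc[of k] fib_luc_Suc[of "k + 1"] fib_luc_Suc[of "k - 1"] fib_luc_Suc[of "k - 2"] assms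
  by (auto simp: add.commute)

text \<open>Multiplication of \<open>\<rho> k + \<pi> k * sqrt 2\<close> by the unit
  \<open>1 + sqrt 2\<close>.\<close>

lemma pell_rho_Suc:
  assumes "k \<ge> -1"
  shows "\<pi> (k + 1) = \<pi> k + \<rho> k \<and> \<rho> (k + 1) = 2 * \<pi> k + \<rho> k"
  using assms
proof (induction k rule: int_ge_induct)
  case base
  then show ?case by (simp add: seq_initial_values)
next
  case (step k)
  then show ?case
    using pell_seq_rec[of "k + 1"] rho_seq_rec[of "k + 1"] by auto
qed

text \<open>Multiplication of \<open>\<zeta> 1 k + \<zeta> 0 k * sqrt 3\<close> by the unit
  \<open>2 + sqrt 3\<close>; the next lemma does the same for the indices 3 and 2.\<close>

lemma zeta_1_0_Suc:
  assumes "k \<ge> -1"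
  shows "\<zeta> 1 (k + 1) = 2 * \<zeta> 1 k + 3 * \<zeta> 0 k \<and> \<zeta> 0 (k + 1) = 2 * \<zeta> 0 k + \<zeta> 1 k"
  using assms
proof (induction k rule: int_ge_induct)
  case base
  then show ?case using seq_initial_values by simp
next
  case (step k)
  then show ?case
    using zeta_seq_rec[of "k + 1" 0] zeta_seq_rec[of "k + 1" 1] by auto
qed

lemma zeta_3_2_Suc:
  assumes "k \<ge> -1"
  shows "\<zeta> 3 (k + 1) = 2 * \<zeta> 3 k + 3 * \<zeta> 2 k \<and> \<zeta> 2 (k + 1) = 2 * \<zeta> 2 k + \<zeta> 3 k"
  using assms
proof (induction k rule: int_ge_induct)
  case base
  then show ?case using seq_initial_values by simp
next
  case (step k)
  then show ?case
    using zeta_seq_rec[of "k + 1" 2] zeta_seq_rec[of "k + 1" 3] by auto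
qed

section \<open>Descent for the Pell equations\<close>

lemma mult_self_ge: "x\<^sup>2 \<ge> b * b" if "b \<ge> 0" "x \<ge> b" for x b :: int
  using that by (simp add: power2_eq_square mult_mono)

text \<open>Dividing \<open>(x + y * sqrt 5) / 2\<close> by \<open>(1 + sqrt 5) / 2\<close> gives a
  smaller solution. That unit has norm -1, so the sign of the right-hand side alternates and both
  signs are treated together.\<close>

lemma pell_5:
  fixes x y :: int
  assumes "x \<ge> 0" "y \<ge> 0" "x\<^sup>2 - 5 * y\<^sup>2 \<in> {4, -4}"
  shows "\<exists>k\<ge>0. x = \<psi> k \<and> y = \<phi> k"
  using assms
proof (induction "nat y" arbitrary: x y rule: less_induct)
  case less
  consider "y = 0" | "y = 1" | "y \<ge> 2" using less.prems(2) by linarith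
  then show ?case
  proof cases
    case 1
    then have "x\<^sup>2 = 4 \<or> x\<^sup>2 = -4" using less.prems(3) by auto
    moreover have "x\<^sup>2 \<ge> 0" by simp
    ultimately have "x\<^sup>2 = 2\<^sup>2" by simp
    then have "x = 2" using less.prems(1) by (simp only: power2_eq_iff_nonneg zero_le_numeral)
    then show ?thesis using 1 seq_initial_values by (intro exI[of _ 0]) simp
  next
    \<comment> \<open>Here \<open>x\<close> is 1 or 3, which are the indices \<open>k = 1\<close>
      and \<open>k = 2\<close>; the descent would not decrease \<open>y\<close> when
      \<open>x = 3\<close>.\<close>
    case 2
    then have "x\<^sup>2 = 3\<^sup>2 \<or> x\<^sup>2 = 1\<^sup>2" using less.prems(3) by auto
    then have "x = 3 \<or> x = 1"
      using less.prems(1) by (simp only: power2_eq_iff_nonneg zero_le_numeral zero_le_one)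
    moreover have "\<phi> 2 = 1" "\<psi> 2 = 3"
      using fib_seq_rec[of 0] luc_seq_rec[of 0] seq_initial_values by simp_all
    ultimately show ?thesis using 2 seq_initial_values
      by (metis zero_le_numeral zero_le_one)
  next
    case 3
    then have y4: "y\<^sup>2 \<ge> 4" using mult_self_ge[of 2 y] by simp
    have "x\<^sup>2 - 5 * y\<^sup>2 = 2 * 2 \<or> x\<^sup>2 - 5 * y\<^sup>2 = 2 * (-2)" using less.prems(3) by auto
    then have "even (x\<^sup>2 - 5 * y\<^sup>2)" by (metis dvd_triv_left)
    then have "even (x - y)" by simp
    then obtain z where z: "x = y + 2 * z" by (metis add.commute diff_add_cancel dvdE)
    have "x\<^sup>2 - 5 * y\<^sup>2 = 4 \<or> x\<^sup>2 - 5 * y\<^sup>2 = -4" using less.prems(3) by auto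
    then have "y\<^sup>2 \<le> x\<^sup>2" using y4 by arith
    then have "y \<le> x" using less.prems(1) by (rule power2_le_imp_le)
    \<comment> \<open>This amounts to \<open>z < y\<close>. It needs
      \<open>5 * y\<^sup>2 + 4 < 9 * y\<^sup>2\<close>, that is \<open>y \<ge> 2\<close>.\<close>
    moreover have "x < 3 * y"
      using less.prems y4 by - (rule power2_less_imp_less, auto simp: power_mult_distrib)
    ultimately have bounds: "0 \<le> z" "z < y" "0 \<le> 2 * y - z" using z by auto
    have "(2 * y - z)\<^sup>2 - 5 * z\<^sup>2 = - (x\<^sup>2 - 5 * y\<^sup>2)" unfolding z by algebra
    then have "(2 * y - z)\<^sup>2 - 5 * z\<^sup>2 \<in> {4, -4}" using less.prems(3) by auto
    then obtain k where k: "k \<ge> 0" "2 * y - z = \<psi> k" "z = \<phi> k"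
      using less.hyps[of z "2 * y - z"] bounds by auto
    then have "x = \<psi> (k + 1) \<and> y = \<phi> (k + 1)" using z fib_luc_Suc[of k] by auto
    then show ?thesis using k(1) by (intro exI[of _ "k + 1"]) simp
  qed
qed

text \<open>Descent by division by \<open>1 + sqrt 2\<close>, again of norm -1, down to
  \<open>y = 0\<close>.\<close>

lemma pell_2:
  fixes x y :: int
  assumes "x \<ge> 0" "y \<ge> 0" "x\<^sup>2 - 2 * y\<^sup>2 \<in> {1, -1}"
  shows "\<exists>k\<ge>0. x = \<rho> k \<and> y = \<pi> k"
  using assms
proof (induction "nat y" arbitrary: x y rule: less_induct)
  case less
  show ?case
  proof (cases "y = 0")
    case True
    then have "x\<^sup>2 = 1 \<or> x\<^sup>2 = -1" using less.prems(3) by auto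
    moreover have "x\<^sup>2 \<ge> 0" by simp
    ultimately have "x\<^sup>2 = 1" by linarith
    then have "x = 1" using less.prems(1) by (auto simp: power2_eq_1_iff)
    then show ?thesis using True seq_initial_values by (intro exI[of _ 0]) simp
  next
    case False
    then have y1: "y\<^sup>2 \<ge> 1" using less.prems(2) mult_self_ge[of 1 y] by simp
    have "x\<^sup>2 - 2 * y\<^sup>2 = 1 \<or> x\<^sup>2 - 2 * y\<^sup>2 = -1" using less.prems(3) by auto
    then have "y\<^sup>2 \<le> x\<^sup>2" using y1 by arith
    then have "y \<le> x" using less.prems(1) by (rule power2_le_imp_le)
    moreover have "x < 2 * y"
      using less.prems y1 by - (rule power2_less_imp_less, auto simp: power_mult_distrib)
    moreover have "(2 * y - x)\<^sup>2 - 2 * (x - y)\<^sup>2 = - (x\<^sup>2 - 2 * y\<^sup>2)" by algebra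
    then have "(2 * y - x)\<^sup>2 - 2 * (x - y)\<^sup>2 \<in> {1, -1}" using less.prems(3) by auto
    ultimately obtain k where k: "k \<ge> 0" "2 * y - x = \<rho> k" "x - y = \<pi> k"
      using less.hyps[of "x - y" "2 * y - x"] by auto
    then have "x = \<rho> (k + 1) \<and> y = \<pi> (k + 1)" using pell_rho_Suc[of k] by auto
    then show ?thesis using k(1) by (intro exI[of _ "k + 1"]) simp
  qed
qed

text \<open>Descent by division by \<open>2 + sqrt 3\<close>. Its norm is 1, so the right-hand side
  is preserved.\<close>

lemma pell_3:
  fixes x y :: int
  assumes "x \<ge> 0" "y \<ge> 0" "x\<^sup>2 - 3 * y\<^sup>2 = 1"
  shows "\<exists>k\<ge>0. x = \<zeta> 1 k \<and> y = \<zeta> 0 k"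
  using assms
proof (induction "nat y" arbitrary: x y rule: less_induct)
  case less
  show ?case
  proof (cases "y = 0")
    case True
    then have "x\<^sup>2 = 1" using less.prems(3) by auto
    then have "x = 1" using less.prems(1) by (auto simp: power2_eq_1_iff)
    then show ?thesis using True seq_initial_values by (intro exI[of _ 0]) simp
  next
    case False
    then have y1: "y\<^sup>2 \<ge> 1" using less.prems(2) mult_self_ge[of 1 y] by simp
    have "y < x" using less.prems y1 by - (rule power2_less_imp_less, auto)
    moreover have "x \<le> 2 * y"
      using less.prems y1 by - (rule power2_le_imp_le, auto simp: power_mult_distrib)
    moreover have "3 * y \<le> 2 * x"
      using less.prems y1 by - (rule power2_le_imp_le, auto simp: power_mult_distrib)
    moreover have "(2 * x - 3 * y)\<^sup>2 - 3 * (2 * y - x)\<^sup>2 = x\<^sup>2 - 3 * y\<^sup>2" by algebra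
    ultimately obtain k where k: "k \<ge> 0" "2 * x - 3 * y = \<zeta> 1 k" "2 * y - x = \<zeta> 0 k"
      using less.hyps[of "2 * y - x" "2 * x - 3 * y"] less.prems(3) by auto
    then have "x = \<zeta> 1 (k + 1) \<and> y = \<zeta> 0 (k + 1)" using zeta_1_0_Suc[of k] by auto
    then show ?thesis using k(1) by (intro exI[of _ "k + 1"]) simp
  qed
qed

text \<open>The same descent, stopping at \<open>x = y = 1\<close>: there the new first coordinate
  \<open>2 * x - 3 * y\<close> would be negative.\<close>

lemma pell_3_minus_2:
  fixes x y :: int
  assumes "x \<ge> 0" "y \<ge> 0" "x\<^sup>2 - 3 * y\<^sup>2 = -2"
  shows "\<exists>k\<ge>0. x = \<zeta> 3 k \<and> y = \<zeta> 2 k"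
  using assms
proof (induction "nat y" arbitrary: x y rule: less_induct)
  case less
  have "y \<noteq> 0"
  proof
    assume "y = 0"
    then have "x\<^sup>2 = -2" using less.prems(3) by simp
    then show False using zero_le_power2[of x] by linarith
  qed
  then consider "y = 1" | "y \<ge> 2" using less.prems(2) by linarith
  then show ?case
  proof cases
    case 1
    then have "x\<^sup>2 = 1" using less.prems(3) by auto
    then have "x = 1" using less.prems(1) by (auto simp: power2_eq_1_iff)
    then show ?thesis using 1 seq_initial_values by (intro exI[of _ 0]) simp
  next
    case 2
    then have y4: "y\<^sup>2 \<ge> 4" using mult_self_ge[of 2 y] by simp
    have "y < x" using less.prems y4 by - (rule power2_less_imp_less, auto)
    moreover have "x \<le> 2 * y"
      using less.prems y4 by - (rule power2_le_imp_le, auto simp: power_mult_distrib)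
    moreover have "3 * y \<le> 2 * x"
      using less.prems y4 by - (rule power2_le_imp_le, auto simp: power_mult_distrib)
    moreover have "(2 * x - 3 * y)\<^sup>2 - 3 * (2 * y - x)\<^sup>2 = x\<^sup>2 - 3 * y\<^sup>2" by algebra
    ultimately obtain k where k: "k \<ge> 0" "2 * x - 3 * y = \<zeta> 3 k" "2 * y - x = \<zeta> 2 k"
      using less.hyps[of "2 * y - x" "2 * x - 3 * y"] less.prems(3) by auto
    then have "x = \<zeta> 3 (k + 1) \<and> y = \<zeta> 2 (k + 1)" using zeta_3_2_Suc[of k] by auto
    then show ?thesis using k(1) by (intro exI[of _ "k + 1"]) simp
  qed
qed


section \<open>Solving for the parameters\<close>

text \<open>Since \<open>P / Q = \<alpha> / \<beta> + 2 + \<beta> / \<alpha>\<close>, the quotients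
  0, 1, 2, 3, 4 belong to \<alpha>/\<beta> of order 2, 3, 4, 6, 1. Excluding them accounts for the
  exceptional parameters in the list.\<close>

definition admissible :: "int \<Rightarrow> int \<Rightarrow> bool" where
  "admissible P Q \<longleftrightarrow> coprime P Q \<and> Q \<noteq> 0 \<and>
     P \<noteq> 0 \<and> P \<noteq> Q \<and> P \<noteq> 2 * Q \<and> P \<noteq> 3 * Q \<and> P \<noteq> 4 * Q"

lemma admissible_uminus [simp]: "admissible (- P) (- Q) \<longleftrightarrow> admissible P Q"
  by (auto simp: admissible_def)

text \<open>This is the effect of replacing \<beta> by -\<beta>. It sends \<open>P / Q\<close> to
  \<open>4 - P / Q\<close>, which permutes the excluded quotients.\<close>

lemma admissible_swap: "admissible P Q \<Longrightarrow> admissible (P - 4 * Q) (- Q)"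
proof -
  assume a: "admissible P Q"
  have "coprime (P - 4 * Q) Q"
  proof (rule coprimeI)
    fix c assume c: "c dvd P - 4 * Q" "c dvd Q"
    then have "c dvd (P - 4 * Q) + 4 * Q" by (intro dvd_add) auto
    then show "is_unit c"
      using a c(2) coprime_common_divisor[of P Q c] by (simp add: admissible_def)
  qed
  then show ?thesis using a by (auto simp: admissible_def)
qed

lemma defective_parameters_admissible:
  assumes "defective_parameters n P Q"
  shows "admissible P Q"
proof -
  have "lehmer_int P Q 3 \<noteq> 0" "lehmer_int P Q 4 \<noteq> 0" "lehmer_int P Q 6 \<noteq> 0"
    using assms by (simp_all add: defective_parameters_def)
  then show ?thesis
    using assms by (auto simp: admissible_def defective_parameters_def lehmer_int_values)
qed

lemma coprime_not_dvd_both: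
  fixes p :: int
  assumes "coprime a b" "p > 1" "p dvd b"
  shows "\<not> p dvd a"
  using assms coprime_common_divisor[of a b p] by (auto simp: zdvd1_eq)

section \<open>The linear forms: indices 3, 4 and 6\<close>

text \<open>The list parameter \<open>q\<close> is \<open>Q\<close>, and \<open>m = 0\<close> gives
  the first family. The exception \<open>(1, 1)\<close> would mean \<open>P = 4 * Q\<close>.\<close>

lemma listed_3:
  assumes "admissible P Q" "P - Q = 3 ^ m"
  shows "listed 3 P (P - 4 * Q)"
proof (cases "m = 0")
  case True
  then have P: "P = 1 + Q" using assms(2) by simp
  then have "Q \<notin> {-1, 0, 1}" using assms(1) by (auto simp: admissible_def)
  then show ?thesis using listed.three_a[of Q] P by simp
next
  case False
  have P: "P = 3 ^ m + Q" using assms(2) by simp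
  have "\<not> 3 dvd Q"
    using assms(1) coprime_not_dvd_both[of P Q 3] False by (auto simp: P admissible_def)
  moreover have "(int m, Q) \<noteq> (1, 1)"
    using assms(1) by (auto simp: P admissible_def)
  ultimately show ?thesis
    using listed.three_b[of "int m" Q] False P by simp
qed

lemma listed_4:
  assumes "admissible P Q" "P - 2 * Q = 2 ^ m"
  shows "listed 4 P (P - 4 * Q)"
proof (cases "m = 0")
  case True
  then have P: "P = 1 + 2 * Q" using assms(2) by simp
  then have "Q \<notin> {-1, 0, 1}" using assms(1) by (auto simp: admissible_def)
  then show ?thesis using listed.four_a[of Q] P by simp
next
  case False
  have P: "P = 2 ^ m + 2 * Q" using assms(2) by simp
  have "\<not> 2 dvd Q"
    using assms(1) coprime_not_dvd_both[of P Q 2] False by (auto simp: P admissible_def)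
  moreover have "(int m, Q) \<notin> {(1, -1), (1, 1)}"
    using assms(1) by (auto simp: P admissible_def)
  ultimately show ?thesis
    using listed.four_b[of "int m" Q] False P by simp
qed

text \<open>The four families correspond to which of the exponents \<open>i\<close> and
  \<open>j\<close> vanish.\<close>

lemma listed_6:
  assumes "admissible P Q" "P - 3 * Q = 2 ^ i * 3 ^ j"
  shows "listed 6 P (P - 4 * Q)"
proof -
  have P: "P = 2 ^ i * 3 ^ j + 3 * Q" using assms(2) by simp
  have 2: "\<not> 2 dvd Q" if "i > 0"
    using assms(1) coprime_not_dvd_both[of P Q 2] that by (auto simp: P admissible_def)
  have 3: "\<not> 3 dvd Q" if "j > 0"
    using assms(1) coprime_not_dvd_both[of P Q 3] that by (auto simp: P admissible_def)
  consider "i = 0" "j = 0" | "i = 0" "j > 0" | "i > 0" "j = 0" | "i > 0" "j > 0" by blast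
  then show ?thesis
  proof cases
    case 1
    then have "Q \<notin> {-1, 0, 1}" using assms(1) by (auto simp: P admissible_def)
    then show ?thesis using listed.six_a[of Q] 1 P by simp
  next
    case c: 2
    then have "(int j, Q) \<noteq> (1, -1)" using assms(1) by (auto simp: P admissible_def)
    then show ?thesis using listed.six_b[of "int j" Q] 3 c P by simp
  next
    case c: 3
    then have "(int i, Q) \<noteq> (1, -1)" using assms(1) by (auto simp: P admissible_def)
    then show ?thesis using listed.six_c[of "int i" Q] 2 c P by simp
  next
    case 4
    have "coprime (2 * 3) Q"
      unfolding coprime_mult_left_iff using 2 3 4 by (simp add: prime_imp_coprime)
    then have "gcd 6 Q = 1" by simp
    then show ?thesis using listed.six_d[of "int i" "int j" Q] 4 P by simp
  qed
qed

section \<open>The quadratic forms and their Pell equations: indices 5, 10, 8 and 12\<close>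

text \<open>Completing the square turns \<open>F\<close> into
  \<open>(2 * X - 3 * Y)\<^sup>2 - 5 * Y\<^sup>2 = 4 * F\<close>, where \<open>F\<close> is 1 or 5
  up to sign. In the first case \<open>\<psi> k\<close> is the absolute value of
  \<open>2 * X - 3 * Y\<close> and \<open>\<phi> k\<close> is \<open>Y\<close>; in the second, 5
  divides \<open>2 * X - 3 * Y\<close> and \<open>Y\<close> becomes \<open>\<psi> k\<close>. Index
  10 uses the same solutions with \<open>X - 4 * Y\<close> in the place of \<open>P\<close>.\<close>

lemma listed_5_10:
  fixes X Y :: int
  assumes adm: "admissible X Y" and Y: "Y > 0" and F0: "X\<^sup>2 - 3 * X * Y + Y\<^sup>2 \<noteq> 0"
    and F5: "\<And>r. prime r \<Longrightarrow> r dvd X\<^sup>2 - 3 * X * Y + Y\<^sup>2 \<Longrightarrow> r = 5"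
  shows "listed 5 X (X - 4 * Y) \<and> listed 10 (X - 4 * Y) X"
proof -
  define F where "F = X\<^sup>2 - 3 * X * Y + Y\<^sup>2"
  have sq: "(2 * X - 3 * Y)\<^sup>2 = 5 * Y\<^sup>2 + 4 * F"
    unfolding F_def by algebra
  have dvd5: "\<exists>z. 2 * X - 3 * Y = 5 * z \<and> Y\<^sup>2 = 5 * z\<^sup>2 - 4 * t" if t: "F = 5 * t" for t
  proof -
    have "(2 * X - 3 * Y)\<^sup>2 = 5 * (Y\<^sup>2 + 4 * t)" using sq t by simp
    then have "5 dvd (2 * X - 3 * Y)\<^sup>2" by simp
    then have "5 dvd 2 * X - 3 * Y" by (rule prime_dvd_power[rotated]) simp
    then obtain z where z: "2 * X - 3 * Y = 5 * z" by blast
    then have "(5 * z)\<^sup>2 = 5 * (Y\<^sup>2 + 4 * t)" using sq t by simp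
    then have "Y\<^sup>2 = 5 * z\<^sup>2 - 4 * t" by (simp add: power_mult_distrib)
    then show ?thesis using z by blast
  qed
  have n25: "\<not> 5\<^sup>2 dvd F"
  proof
    assume "5\<^sup>2 dvd F"
    then obtain t where "F = 5 * (5 * t)" by (auto simp: dvd_def power2_eq_square)
    then obtain z where z: "2 * X - 3 * Y = 5 * z" "Y\<^sup>2 = 5 * z\<^sup>2 - 4 * (5 * t)" using dvd5 by blast
    then have "Y\<^sup>2 = 5 * (z\<^sup>2 - 4 * t)" by simp
    then have "5 dvd Y\<^sup>2" by simp
    then have "5 dvd Y" by (rule prime_dvd_power[rotated]) simp
    moreover from this have "5 dvd X" using z(1) by presburger
    ultimately show False using adm coprime_not_dvd_both[of X Y 5] by (auto simp: admissible_def)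
  qed
  then have "\<bar>F\<bar> \<in> {1, 5, 5, 5 * 5}"
    using int_squarefree_two_primes[of F 5 5] F0 F5 unfolding F_def by blast
  moreover have "\<bar>F\<bar> \<noteq> 25"
  proof
    assume "\<bar>F\<bar> = 25"
    then have "5\<^sup>2 dvd \<bar>F\<bar>" by simp
    then show False using n25 by (simp only: dvd_abs_iff)
  qed
  ultimately have "F = 1 \<or> F = -1 \<or> F = 5 \<or> F = -5" by auto
  then consider "F = 1 \<or> F = -1" | t where "F = 5 * t" "t = 1 \<or> t = -1" by fastforce
  then show ?thesis
  proof cases
    case 1
    then have "\<bar>2 * X - 3 * Y\<bar>\<^sup>2 - 5 * Y\<^sup>2 \<in> {4, -4}" unfolding power2_abs sq by auto
    then obtain k where k: "k \<ge> 0" "\<bar>2 * X - 3 * Y\<bar> = \<psi> k" "Y = \<phi> k"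
      using pell_5[of "\<bar>2 * X - 3 * Y\<bar>" Y] Y by auto
    have v: "\<phi> 2 = 1" "\<psi> 2 = 3"
      using fib_seq_rec[of 0] luc_seq_rec[of 0] seq_initial_values by simp_all
    \<comment> \<open>\<open>k = 0\<close> gives \<open>Y = 0\<close>. For \<open>k = 1\<close> and
      \<open>k = 2\<close>, \<open>Y = 1\<close> and \<open>X\<close> lies in \<open>{1, 2}\<close>
      and \<open>{0, 3}\<close> respectively, all inadmissible.\<close>
    have "k \<noteq> 0" "k \<noteq> 1" "k \<noteq> 2"
      using k adm v seq_initial_values by (auto simp: admissible_def)
    then have "k \<ge> 3" using k(1) by linarith
    \<comment> \<open>The sign of \<open>2 * X - 3 * Y\<close> decides the value of \<epsilon>:
      negative for 1, positive for -1.\<close>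
    moreover have "X = \<phi> (k - 2 * 1) \<or> X = \<phi> (k - 2 * (-1))"
      using fib_luc_shift_2(1,2)[OF k(1)] k by (simp add: add.commute) arith
    ultimately show ?thesis
      using listed.five_a[of 1 k] listed.five_a[of "-1" k] listed.ten_a[of 1 k] listed.ten_a[of "-1" k] k(3)
      by auto
  next
    case (2 t)
    obtain z where z: "2 * X - 3 * Y = 5 * z" "Y\<^sup>2 = 5 * z\<^sup>2 - 4 * t" using dvd5 2(1) by blast
    then have "Y\<^sup>2 - 5 * \<bar>z\<bar>\<^sup>2 \<in> {4, -4}" using 2(2) by auto
    then obtain k where k: "k \<ge> 0" "Y = \<psi> k" "\<bar>z\<bar> = \<phi> k"
      using pell_5[of Y "\<bar>z\<bar>"] Y by auto
    have X: "X = \<psi> (k - 2) \<or> X = \<psi> (k + 2)"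
      using fib_luc_shift_2[OF k(1)] k z(1) by arith
    \<comment> \<open>For \<open>k = 0\<close> both choices equal 3; for \<open>k = 1\<close> the
      choice \<open>\<psi> 3 = 4\<close> would give \<open>X = 4 * Y\<close>. This removes the
      parameters \<open>(0, -1)\<close> and \<open>(1, -1)\<close> that the list excludes.\<close>
    have "X = \<psi> (k - 2)" if "k = 0 \<or> k = 1"
    proof -
      have "\<psi> 2 = 3" "\<psi> 3 = 4"
        using luc_seq_rec[of 0] luc_seq_rec[of 1] seq_initial_values by simp_all
      then show ?thesis
        using that X k(2) adm seq_initial_values by (auto simp: admissible_def)
    qed
    then consider "X = \<psi> (k - 2 * 1)" | "X = \<psi> (k - 2 * (-1))" "k \<noteq> 0" "k \<noteq> 1"
      using X by auto
    then show ?thesis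
    proof cases
      case 1
      then show ?thesis using listed.five_b[of 1 k] listed.ten_b[of 1 k] k(1,2) by simp
    next
      case 2
      then show ?thesis using listed.five_b[of "-1" k] listed.ten_b[of "-1" k] k(1,2) by simp
    qed
  qed
qed

text \<open>Here \<open>G = (P - 2 * Q)\<^sup>2 - 2 * Q\<^sup>2\<close> is 1 or 2 up to sign. The
  value 1 makes \<open>Q\<close> a term of \<open>\<pi>\<close>; the value 2 forces
  \<open>P - 2 * Q\<close> to be even and makes \<open>Q\<close> a term of
  \<open>\<rho>\<close>.\<close>

lemma listed_8:
  fixes P Q :: int
  assumes adm: "admissible P Q" and Q: "Q > 0" and G0: "P\<^sup>2 - 4 * P * Q + 2 * Q\<^sup>2 \<noteq> 0"
    and G2: "\<And>r. prime r \<Longrightarrow> r dvd P\<^sup>2 - 4 * P * Q + 2 * Q\<^sup>2 \<Longrightarrow> r = 2"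
  shows "listed 8 P (P - 4 * Q)"
proof -
  define G where "G = P\<^sup>2 - 4 * P * Q + 2 * Q\<^sup>2"
  have sq: "(P - 2 * Q)\<^sup>2 = 2 * Q\<^sup>2 + G"
    unfolding G_def by algebra
  have dvd2: "\<exists>y. P - 2 * Q = 2 * y \<and> Q\<^sup>2 = 2 * y\<^sup>2 - t" if t: "G = 2 * t" for t
  proof -
    have "(P - 2 * Q)\<^sup>2 = 2 * (Q\<^sup>2 + t)" using sq t by simp
    then have "2 dvd (P - 2 * Q)\<^sup>2" by simp
    then have "2 dvd P - 2 * Q" by (rule prime_dvd_power[rotated]) simp
    then obtain y where y: "P - 2 * Q = 2 * y" by blast
    then have "(2 * y)\<^sup>2 = 2 * (Q\<^sup>2 + t)" using sq t by simp
    then have "Q\<^sup>2 = 2 * y\<^sup>2 - t" by (simp add: power_mult_distrib)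
    then show ?thesis using y by blast
  qed
  have n4: "\<not> 2\<^sup>2 dvd G"
  proof
    assume "2\<^sup>2 dvd G"
    then obtain t where "G = 2 * (2 * t)" by (auto simp: dvd_def power2_eq_square)
    then obtain y where y: "P - 2 * Q = 2 * y" "Q\<^sup>2 = 2 * y\<^sup>2 - 2 * t" using dvd2 by blast
    then have "Q\<^sup>2 = 2 * (y\<^sup>2 - t)" by simp
    then have "2 dvd Q\<^sup>2" by simp
    then have "2 dvd Q" by (rule prime_dvd_power[rotated]) simp
    moreover from this have "2 dvd P" using y(1) by presburger
    ultimately show False using adm coprime_not_dvd_both[of P Q 2] by (auto simp: admissible_def)
  qed
  then have "\<bar>G\<bar> \<in> {1, 2, 2, 2 * 2}"
    using int_squarefree_two_primes[of G 2 2] G0 G2 unfolding G_def by blast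
  moreover have "\<bar>G\<bar> \<noteq> 4"
  proof
    assume "\<bar>G\<bar> = 4"
    then have "2\<^sup>2 dvd \<bar>G\<bar>" by simp
    then show False using n4 by (simp only: dvd_abs_iff)
  qed
  ultimately have "G = 1 \<or> G = -1 \<or> G = 2 \<or> G = -2" by auto
  then consider "G = 1 \<or> G = -1" | t where "G = 2 * t" "t = 1 \<or> t = -1" by fastforce
  then show ?thesis
  proof cases
    case 1
    then have "\<bar>P - 2 * Q\<bar>\<^sup>2 - 2 * Q\<^sup>2 \<in> {1, -1}" unfolding power2_abs sq by auto
    then obtain k where k: "k \<ge> 0" "\<bar>P - 2 * Q\<bar> = \<rho> k" "Q = \<pi> k"
      using pell_2[of "\<bar>P - 2 * Q\<bar>" Q] Q by auto
    have "k \<noteq> 0" "k \<noteq> 1"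
      using k adm seq_initial_values by (auto simp: admissible_def)
    then have "k \<ge> 2" using k(1) by linarith
    moreover have "P = \<rho> (k - 1) \<or> P = \<rho> (k - (-1))"
      using pell_rho_Suc[of k] pell_rho_Suc[of "k - 1"] k by (simp add: add.commute) arith
    ultimately show ?thesis
      using listed.eight_a[of 1 k] listed.eight_a[of "-1" k] k(3) by auto
  next
    case (2 t)
    obtain y where y: "P - 2 * Q = 2 * y" "Q\<^sup>2 = 2 * y\<^sup>2 - t" using dvd2 2(1) by blast
    then have "Q\<^sup>2 - 2 * \<bar>y\<bar>\<^sup>2 \<in> {1, -1}" using 2(2) by auto
    then obtain k where k: "k \<ge> 0" "Q = \<rho> k" "\<bar>y\<bar> = \<pi> k"
      using pell_2[of Q "\<bar>y\<bar>"] Q by auto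
    \<comment> \<open>In both cases \<open>Q = 1\<close>, with \<open>P = 2\<close> for
      \<open>k = 0\<close> and \<open>P\<close> in \<open>{0, 4}\<close> for
      \<open>k = 1\<close>.\<close>
    have "k \<noteq> 0" "k \<noteq> 1"
      using k y(1) adm seq_initial_values by (auto simp: admissible_def)
    then have "k \<ge> 2" using k(1) by linarith
    moreover have "P = 2 * \<pi> (k - 1) \<or> P = 2 * \<pi> (k - (-1))"
      using pell_rho_Suc[of k] pell_rho_Suc[of "k - 1"] k y(1) by (simp add: add.commute) arith
    ultimately show ?thesis
      using listed.eight_b[of 1 k] listed.eight_b[of "-1" k] k(2) by auto
  qed
qed

lemma power2_mod_3: "x\<^sup>2 mod 3 \<noteq> 2" for x :: int
proof -
  have "x mod 3 = 0 \<or> x mod 3 = 1 \<or> x mod 3 = 2" by presburger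
  moreover have "x\<^sup>2 mod 3 = (x mod 3)\<^sup>2 mod 3" by (simp add: power_mod)
  ultimately show ?thesis by auto
qed

text \<open>With \<open>Q = \<zeta> i k\<close>, the recurrence says that subtracting
  \<open>4 * Q\<close> turns one neighbour of \<open>\<zeta> i k\<close> into the negative of the
  other, so both neighbours fit the rule.\<close>

lemma listed_12_zeta:
  assumes "i \<in> {0, 1, 2, 3}" "k \<ge> 0" "(i, k) \<notin> {(0, 0), (0, 1), (1, 0), (2, 0)}"
    and "Q = \<zeta> i k" "P = \<zeta> i (k - 1) \<or> P = \<zeta> i (k + 1)"
  shows "listed 12 P (P - 4 * Q)"
proof -
  have eq: "\<zeta> i (k - 1) - 4 * Q = - \<zeta> i (k + 1)" "\<zeta> i (k + 1) - 4 * Q = - \<zeta> i (k - 1)"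
    using zeta_seq_rec[of k i] assms(2,4) by auto
  note twelve = listed.twelve[OF _ assms(1-3)]
  from assms(5) show ?thesis
  proof
    assume "P = \<zeta> i (k - 1)"
    then show ?thesis using twelve[of 1] by (simp only: eq) simp
  next
    assume "P = \<zeta> i (k + 1)"
    then show ?thesis using twelve[of "-1"] by (simp only: eq) simp
  qed
qed

text \<open>\<open>H = (P - 2 * Q)\<^sup>2 - 3 * Q\<^sup>2\<close> divides 6 once 4 and 9 are
  excluded, and squares modulo 3 leave only 1, -3, -2 and 6. These four values yield the sequences
  with \<open>i\<close> equal to 0, 1, 2 and 3 in this order.\<close>

lemma listed_12:
  fixes P Q :: int
  assumes adm: "admissible P Q" and Q: "Q > 0" and H0: "P\<^sup>2 - 4 * P * Q + Q\<^sup>2 \<noteq> 0"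
    and H23: "\<And>r. prime r \<Longrightarrow> r dvd P\<^sup>2 - 4 * P * Q + Q\<^sup>2 \<Longrightarrow> r = 2 \<or> r = 3"
  shows "listed 12 P (P - 4 * Q)"
proof -
  define H where "H = P\<^sup>2 - 4 * P * Q + Q\<^sup>2"
  have sq: "(P - 2 * Q)\<^sup>2 = 3 * Q\<^sup>2 + H"
    unfolding H_def by algebra
  have cop: "\<not> (p dvd P \<and> p dvd Q)" if "p > 1" for p
    using adm coprime_not_dvd_both[of P Q p] that by (auto simp: admissible_def)
  have dvd3: "\<exists>z. P - 2 * Q = 3 * z \<and> Q\<^sup>2 = 3 * z\<^sup>2 - t" if t: "H = 3 * t" for t
  proof -
    have "(P - 2 * Q)\<^sup>2 = 3 * (Q\<^sup>2 + t)" using sq t by simp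
    then have "3 dvd (P - 2 * Q)\<^sup>2" by simp
    then have "3 dvd P - 2 * Q" by (rule prime_dvd_power[rotated]) simp
    then obtain z where z: "P - 2 * Q = 3 * z" by blast
    then have "(3 * z)\<^sup>2 = 3 * (Q\<^sup>2 + t)" using sq t by simp
    then have "Q\<^sup>2 = 3 * z\<^sup>2 - t" by (simp add: power_mult_distrib)
    then show ?thesis using z by blast
  qed
  have "\<not> 3\<^sup>2 dvd H"
  proof
    assume "3\<^sup>2 dvd H"
    then obtain t where "H = 3 * (3 * t)" by (auto simp: dvd_def power2_eq_square)
    then obtain z where z: "P - 2 * Q = 3 * z" "Q\<^sup>2 = 3 * z\<^sup>2 - 3 * t" using dvd3 by blast
    then have "Q\<^sup>2 = 3 * (z\<^sup>2 - t)" by simp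
    then have "3 dvd Q\<^sup>2" by simp
    then have "3 dvd Q" by (rule prime_dvd_power[rotated]) simp
    moreover from this have "3 dvd P" using z(1) by presburger
    ultimately show False using cop[of 3] by simp
  qed
  moreover have "\<not> 2\<^sup>2 dvd H"
  proof
    assume H4: "2\<^sup>2 dvd H"
    then have "even H" by auto
    then have "odd P" "odd Q" using cop[of 2] unfolding H_def by auto
    then obtain p q where "P = 2 * p + 1" "Q = 2 * q + 1" by (meson oddE)
    \<comment> \<open>For odd \<open>P\<close> and \<open>Q\<close> the form is congruent to 2
      modulo 4.\<close>
    then have "H = 2\<^sup>2 * (p\<^sup>2 + p - 4 * p * q - 2 * p - 2 * q + q\<^sup>2 + q - 1) + 2"
      unfolding H_def by algebra
    then have "(2::int)\<^sup>2 dvd 2" using H4 by (metis dvd_add_right_iff dvd_triv_left)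
    then show False by simp
  qed
  ultimately have "\<bar>H\<bar> \<in> {1, 2, 3, 2 * 3}"
    using int_squarefree_two_primes[of H 2 3] H0 H23 unfolding H_def by blast
  moreover have "H mod 3 \<noteq> 2"
    using power2_mod_3[of "P - 2 * Q"] unfolding sq by simp
  then have "H \<noteq> -1" "H \<noteq> 2" by auto
  moreover have "H \<noteq> 3 * 1"
  proof
    assume "H = 3 * 1"
    then obtain z where "Q\<^sup>2 = 3 * z\<^sup>2 - 1" using dvd3 by blast
    then have "Q\<^sup>2 mod 3 = 2" by presburger
    then show False using power2_mod_3 by blast
  qed
  moreover have "H \<noteq> 3 * (-2)"
  proof
    assume "H = 3 * (-2)"
    then obtain z where "Q\<^sup>2 = 3 * z\<^sup>2 - (-2)" using dvd3 by blast
    then have "Q\<^sup>2 mod 3 = 2" by presburger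
    then show False using power2_mod_3 by blast
  qed
  ultimately consider "H = 1" | "H = -2" | "H = 3 * (-1)" | "H = 3 * 2" by auto
  then show ?thesis
  proof cases
    case 1
    then have "\<bar>P - 2 * Q\<bar>\<^sup>2 - 3 * Q\<^sup>2 = 1" unfolding power2_abs sq by simp
    then obtain k where k: "k \<ge> 0" "\<bar>P - 2 * Q\<bar> = \<zeta> 1 k" "Q = \<zeta> 0 k"
      using pell_3[of "\<bar>P - 2 * Q\<bar>" Q] Q by auto
    have "k \<noteq> 0" "k \<noteq> 1"
    proof -
      show "k \<noteq> 0" using k Q seq_initial_values by auto
      show "k \<noteq> 1"
      proof
        assume "k = 1"
        then have "\<bar>P - 2\<bar> = 2" "Q = 1" using k seq_initial_values by simp_all
        then show False using adm by (auto simp: admissible_def)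
      qed
    qed
    moreover have "P = \<zeta> 0 (k - 1) \<or> P = \<zeta> 0 (k + 1)"
      using zeta_1_0_Suc[of k] zeta_1_0_Suc[of "k - 1"] k by simp arith
    ultimately show ?thesis using listed_12_zeta[of 0 k] k by simp
  next
    case 2
    then have "\<bar>P - 2 * Q\<bar>\<^sup>2 - 3 * Q\<^sup>2 = -2" unfolding power2_abs sq by simp
    then obtain k where k: "k \<ge> 0" "\<bar>P - 2 * Q\<bar> = \<zeta> 3 k" "Q = \<zeta> 2 k"
      using pell_3_minus_2[of "\<bar>P - 2 * Q\<bar>" Q] Q by auto
    have "k \<noteq> 0"
    proof
      assume "k = 0"
      then have "\<bar>P - 2\<bar> = 1" "Q = 1" using k seq_initial_values by simp_all
      then show False using adm by (auto simp: admissible_def)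
    qed
    moreover have "P = \<zeta> 2 (k - 1) \<or> P = \<zeta> 2 (k + 1)"
      using zeta_3_2_Suc[of k] zeta_3_2_Suc[of "k - 1"] k by simp arith
    ultimately show ?thesis using listed_12_zeta[of 2 k] k by simp
  next
    case 3
    then obtain z where z: "P - 2 * Q = 3 * z" "Q\<^sup>2 = 3 * z\<^sup>2 - (-1)" using dvd3 by blast
    then have "Q\<^sup>2 - 3 * \<bar>z\<bar>\<^sup>2 = 1" by simp
    then obtain k where k: "k \<ge> 0" "Q = \<zeta> 1 k" "\<bar>z\<bar> = \<zeta> 0 k"
      using pell_3[of Q "\<bar>z\<bar>"] Q by auto
    have "k \<noteq> 0"
    proof
      assume "k = 0"
      then have "z = 0" "Q = 1" using k seq_initial_values by simp_all
      then show False using adm z(1) by (auto simp: admissible_def)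
    qed
    moreover have "P = \<zeta> 1 (k - 1) \<or> P = \<zeta> 1 (k + 1)"
      using zeta_1_0_Suc[of k] zeta_1_0_Suc[of "k - 1"] k z(1) by simp arith
    ultimately show ?thesis using listed_12_zeta[of 1 k] k by simp
  next
    case 4
    then obtain z where z: "P - 2 * Q = 3 * z" "Q\<^sup>2 = 3 * z\<^sup>2 - 2" using dvd3 by blast
    then have "3 * \<bar>z\<bar>\<^sup>2 - Q\<^sup>2 = 2" by simp
    then have "Q\<^sup>2 - 3 * \<bar>z\<bar>\<^sup>2 = -2" by simp
    then obtain k where k: "k \<ge> 0" "Q = \<zeta> 3 k" "\<bar>z\<bar> = \<zeta> 2 k"
      using pell_3_minus_2[of Q "\<bar>z\<bar>"] Q by auto
    have "P = \<zeta> 3 (k - 1) \<or> P = \<zeta> 3 (k + 1)"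
      using zeta_3_2_Suc[of k] zeta_3_2_Suc[of "k - 1"] k z(1) by simp arith
    then show ?thesis using listed_12_zeta[of 3 k] k by simp
  qed
qed

section \<open>Classification\<close>

text \<open>The two alternatives reflect multiplication by \<i>, which negates \<open>P\<close> and
  \<open>Q\<close>. This freedom makes the linear form positive for the indices 3, 4 and 6, and
  \<open>Q\<close> positive for the others, as the Pell descent requires.\<close>

lemma defective_parameters_listed:
  assumes "n \<in> {3, 4, 5, 6, 8, 10, 12}" and def: "defective_parameters n P Q"
  shows "listed n P (P - 4 * Q) \<or> listed n (- P) (- (P - 4 * Q))"
proof -
  note adm = defective_parameters_admissible[OF def]
  note adm' = admissible_uminus[THEN iffD2, OF adm]
  have nz: "lehmer_int P Q n \<noteq> 0"
    using assms by (auto simp: defective_parameters_def)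
  have sgn: "Q > 0 \<or> - Q > 0"
    using adm by (auto simp: admissible_def)
  from assms(1) consider "n = 3" | "n = 4" | "n = 5" | "n = 6" | "n = 8" | "n = 10" | "n = 12"
    by blast
  then show ?thesis
  proof cases
    case 1
    have "r = 3" if "prime r" "r dvd P - Q" for r
      using prime_dvd_3[OF that(1) defective_3_prime_dvd[OF _ that]] def 1 by simp
    then obtain i j where "\<bar>P - Q\<bar> = 3 ^ i * 3 ^ j"
      using int_two_primes[of "P - Q" 3 3] nz unfolding 1 lehmer_int_3 by metis
    then have "P - Q = 3 ^ (i + j) \<or> - P - (- Q) = 3 ^ (i + j)"
      by (simp add: power_add) arith
    then show ?thesis
      using listed_3[OF adm] listed_3[OF adm'] 1 by auto
  next
    case 2
    have "r = 2" if "prime r" "r dvd P - 2 * Q" for r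
      using prime_dvd_2[OF that(1) defective_4_prime_dvd[OF _ that]] def 2 by simp
    then obtain i j where "\<bar>P - 2 * Q\<bar> = 2 ^ i * 2 ^ j"
      using int_two_primes[of "P - 2 * Q" 2 2] nz unfolding 2 lehmer_int_4 by metis
    then have "P - 2 * Q = 2 ^ (i + j) \<or> - P - 2 * (- Q) = 2 ^ (i + j)"
      by (simp add: power_add) arith
    then show ?thesis
      using listed_4[OF adm] listed_4[OF adm'] 2 by auto
  next
    case 3
    have *: "r = 5" if "prime r" "r dvd P\<^sup>2 - 3 * P * Q + Q\<^sup>2" for r
      using prime_dvd_5[OF that(1) defective_5_prime_dvd[OF _ that]] def 3 by simp
    from sgn show ?thesis
    proof
      assume "Q > 0"
      then show ?thesis using listed_5_10[OF adm] nz * unfolding 3 lehmer_int_5 by simp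
    next
      assume "- Q > 0"
      then show ?thesis using listed_5_10[OF adm'] nz * unfolding 3 lehmer_int_5 by simp
    qed
  next
    case 4
    have "r = 2 \<or> r = 3" if "prime r" "r dvd P - 3 * Q" for r
      using prime_dvd_6[OF that(1) defective_6_prime_dvd[OF _ that]] def 4 by simp
    then obtain i j where "\<bar>P - 3 * Q\<bar> = 2 ^ i * 3 ^ j"
      using int_two_primes[of "P - 3 * Q" 2 3] nz unfolding 4 lehmer_int_6 by (metis mult_zero_right)
    then have "P - 3 * Q = 2 ^ i * 3 ^ j \<or> - P - 3 * (- Q) = 2 ^ i * 3 ^ j"
      by arith
    then show ?thesis
      using listed_6[OF adm] listed_6[OF adm'] 4 by auto
  next
    case 5
    have *: "r = 2" if "prime r" "r dvd P\<^sup>2 - 4 * P * Q + 2 * Q\<^sup>2" for r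
      using prime_dvd_2[OF that(1) defective_8_prime_dvd[OF _ that]] def 5 by simp
    from sgn show ?thesis
    proof
      assume "Q > 0"
      then show ?thesis using listed_8[OF adm] nz * unfolding 5 lehmer_int_8 by simp
    next
      assume "- Q > 0"
      then show ?thesis using listed_8[OF adm'] nz * unfolding 5 lehmer_int_8 by simp
    qed
  next
    case 6
    \<comment> \<open>Replacing \<beta> by -\<beta> carries the form of index 5 to that of index 10;
      \<open>eq'\<close> is the same identity after a change of sign.\<close>
    have eq: "(P - 4 * Q)\<^sup>2 - 3 * (P - 4 * Q) * (- Q) + (- Q)\<^sup>2 = P\<^sup>2 - 5 * P * Q + 5 * Q\<^sup>2"
      by algebra
    have eq': "(- (P - 4 * Q))\<^sup>2 - 3 * (- (P - 4 * Q)) * Q + Q\<^sup>2 = P\<^sup>2 - 5 * P * Q + 5 * Q\<^sup>2"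
      by algebra
    have F0: "P\<^sup>2 - 5 * P * Q + 5 * Q\<^sup>2 \<noteq> 0"
      using nz unfolding 6 lehmer_int_10 by simp
    \<comment> \<open>\<open>P\<close> and \<open>Q\<close> are not both even, so the form is odd
      and 5 is the only prime factor of 20 that can divide it.\<close>
    have "odd (P\<^sup>2 - 5 * P * Q + 5 * Q\<^sup>2)"
      using adm coprime_not_dvd_both[of P Q 2] by (auto simp: admissible_def)
    then have *: "r = 5" if "prime r" "r dvd P\<^sup>2 - 5 * P * Q + 5 * Q\<^sup>2" for r
      using prime_dvd_20[OF that(1) defective_10_prime_dvd[OF _ that]] def 6 that(2) by auto
    note swap = admissible_swap[OF adm]
    from sgn show ?thesis
    proof
      assume "Q > 0"
      \<comment> \<open>The swap makes the second parameter \<open>- Q\<close> negative, so the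
        swapped pair is negated and the second alternative of the goal results.\<close>
      then have "listed 10 (- (P - 4 * Q) - 4 * Q) (- (P - 4 * Q))"
        using listed_5_10[of "- (P - 4 * Q)" Q] swap admissible_uminus[of "P - 4 * Q" "- Q"] F0 *
        unfolding eq' by simp
      then show ?thesis using 6 by simp
    next
      assume "- Q > 0"
      then have "listed 10 (P - 4 * Q - 4 * (- Q)) (P - 4 * Q)"
        using listed_5_10[OF swap] F0 * unfolding eq by simp
      then show ?thesis using 6 by simp
    qed
  next
    case 7
    have *: "r = 2 \<or> r = 3" if "prime r" "r dvd P\<^sup>2 - 4 * P * Q + Q\<^sup>2" for r
      using prime_dvd_6[OF that(1) defective_12_prime_dvd[OF _ that]] def 7 by simp
    from sgn show ?thesis
    proof
      assume "Q > 0"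
      then show ?thesis using listed_12[OF adm] nz * unfolding 7 lehmer_int_12 by simp
    next
      assume "- Q > 0"
      then show ?thesis using listed_12[OF adm'] nz * unfolding 7 lehmer_int_12 by simp
    qed
  qed
qed

section \<open>Return to complex pairs\<close>

text \<open>The quadratic polynomial with roots \<open>x\<close> and \<open>y\<close> may have a
  non-integral linear coefficient, as only the square of \<open>x + y\<close> is an integer. The
  quartic with roots plus and minus \<open>x\<close> and \<open>y\<close> has integer
  coefficients.\<close>

lemma algebraic_int_lehmer:
  fixes x y :: complex
  assumes "(x + y)\<^sup>2 = of_int P" "x * y = of_int Q"
  shows "algebraic_int x"
proof (rule algebraic_int.intros[of "[:(of_int Q)\<^sup>2, 0, - of_int (P - 2 * Q), 0, 1:]"])
  have "(x * y)\<^sup>2 - ((x + y)\<^sup>2 - 2 * (x * y)) * x\<^sup>2 + x ^ 4 = 0" by algebra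
  then show "poly [:(of_int Q)\<^sup>2, 0, - of_int (P - 2 * Q), 0, 1:] x = 0"
    unfolding assms by (simp add: algebra_simps eval_nat_numeral)
  show "\<forall>i. coeff [:(of_int Q)\<^sup>2, 0, - of_int (P - 2 * Q), 0, 1 :: complex:] i \<in> \<int>"
    by (auto simp: coeff_pCons split: nat.split)
qed simp

lemma lehmer_pair_mult_ii:
  assumes "lehmer_pair \<alpha> \<beta>"
  shows "lehmer_pair (\<i> * \<alpha>) (\<i> * \<beta>)"
proof -
  from assms obtain P Q :: int where PQ: "(\<alpha> + \<beta>)\<^sup>2 = of_int P" "\<alpha> * \<beta> = of_int Q"
      "P \<noteq> 0" "Q \<noteq> 0" "coprime P Q"
    and nr: "\<not> (\<exists>m::nat. m > 0 \<and> (\<alpha> / \<beta>) ^ m = 1)"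
    unfolding lehmer_pair_def by blast
  have "(\<i> * \<alpha> + \<i> * \<beta>)\<^sup>2 = - ((\<alpha> + \<beta>)\<^sup>2)"
    by (simp add: power_mult_distrib flip: distrib_left)
  then have P: "(\<i> * \<alpha> + \<i> * \<beta>)\<^sup>2 = of_int (- P)" using PQ(1) by simp
  have Q: "\<i> * \<alpha> * (\<i> * \<beta>) = of_int (- Q)"
    using PQ(2) by (simp add: algebra_simps flip: mult.assoc)
  have "algebraic_int (\<i> * \<alpha>)" "algebraic_int (\<i> * \<beta>)"
    using algebraic_int_lehmer[OF P Q] algebraic_int_lehmer[of "\<i> * \<beta>" "\<i> * \<alpha>" "- P" "- Q"] P Q
    by (simp_all only: add.commute mult.commute)
  moreover have "\<i> * \<alpha> / (\<i> * \<beta>) = \<alpha> / \<beta>" by simp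
  moreover have "- P \<noteq> 0" "- Q \<noteq> 0" "coprime (- P) (- Q)" using PQ(3-5) by simp_all
  ultimately show ?thesis
    unfolding lehmer_pair_def using P Q nr by metis
qed

text \<open>The square roots are \<alpha> + \<beta> and \<beta> - \<alpha>, in this order of
  subtraction, so that the first component \<open>(sa - sb) / 2\<close> is \<alpha>. The second
  claim multiplies both by \<i>.\<close>

lemma has_form_parameters:
  assumes "(\<alpha> + \<beta>)\<^sup>2 = of_int P" "\<alpha> * \<beta> = of_int Q"
  shows "has_form P (P - 4 * Q) (\<alpha>, \<beta>)"
    and "has_form (- P) (- (P - 4 * Q)) (\<i> * \<alpha>, \<i> * \<beta>)"
proof -
  have "(\<beta> - \<alpha>)\<^sup>2 = (\<alpha> + \<beta>)\<^sup>2 - 4 * (\<alpha> * \<beta>)" by algebra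
  then have diff: "(\<beta> - \<alpha>)\<^sup>2 = of_int (P - 4 * Q)" using assms by simp
  then show "has_form P (P - 4 * Q) (\<alpha>, \<beta>)"
    using assms(1) unfolding has_form_def
    by (intro exI[of _ "\<alpha> + \<beta>"] exI[of _ "\<beta> - \<alpha>"]) simp
  have "(\<i> * (\<alpha> + \<beta>))\<^sup>2 = of_int (- P)" "(\<i> * (\<beta> - \<alpha>))\<^sup>2 = of_int (- (P - 4 * Q))"
    unfolding power_mult_distrib diff assms(1) by simp_all
  then show "has_form (- P) (- (P - 4 * Q)) (\<i> * \<alpha>, \<i> * \<beta>)"
    unfolding has_form_def
    by (intro exI[of _ "\<i> * (\<alpha> + \<beta>)"] exI[of _ "\<i> * (\<beta> - \<alpha>)"]) (simp add: algebra_simps)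
qed

theorem theorem1:
  fixes n :: nat and \<alpha> \<beta> :: complex
  assumes "n \<in> {3, 4, 5, 6, 8, 10, 12}"
    and "defective_lehmer_pair n \<alpha> \<beta>"
  shows "\<exists>a b \<alpha>' \<beta>'. listed n a b \<and> has_form a b (\<alpha>', \<beta>') \<and>
           equivalent_lehmer_pairs (\<alpha>, \<beta>) (\<alpha>', \<beta>')"
proof -
  obtain P Q where PQ: "(\<alpha> + \<beta>)\<^sup>2 = of_int P" "\<alpha> * \<beta> = of_int Q"
    and def: "defective_parameters n P Q"
    using defective_lehmer_pair_parameters[OF assms(2)] .
  have lp: "lehmer_pair \<alpha> \<beta>" using assms(2) by (simp add: defective_lehmer_pair_def)
  have nz: "\<alpha> \<noteq> 0" "\<beta> \<noteq> 0"
    using def PQ(2) by (auto simp: defective_parameters_def)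
  then have "equivalent_lehmer_pairs (\<alpha>, \<beta>) (\<alpha>, \<beta>)"
    using lp by (simp add: equivalent_lehmer_pairs_def)
  \<comment> \<open>The common quotient is \<open>1 / \<i> = - \<i>\<close>.\<close>
  moreover have "equivalent_lehmer_pairs (\<alpha>, \<beta>) (\<i> * \<alpha>, \<i> * \<beta>)"
    using nz lp lehmer_pair_mult_ii[OF lp]
    by (simp add: equivalent_lehmer_pairs_def inverse_eq_divide[symmetric] divide_inverse)
  ultimately show ?thesis
    using defective_parameters_listed[OF assms(1) def] has_form_parameters[OF PQ] by blast
qed

end
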